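(* Let $n\ge1$ be an integer and let $t\ge1$, $y\ge0$ be integers with $t\equiv y\pmod2$. Then $$Z^{(n)}_t(y;\kappa)=\frac{\left(\frac{t+y}2-1\right)!}{\left(\frac{t+y}2+2n-2\right)!}\prod_{i=0}^{n-2}\frac{(t+2i)!\,i!\,(y+n+i-1)!}{\left(\frac{t+y}2+n+i-1\right)!\,\left(\frac{t-y}2+i\right)!\,(y+2i)!}$$ $$\times\sum_{\ell=0}^{(t-y)/2}\sum_{k=0}^{n-1}(-1)^k\binom{n-1}{k}\binom{y+2k-2}{2k}\binom{t-\ell-1}{\frac{t-y}2-\ell-k}\binom{y+\ell+2n-2}{2n-2k-1}\frac{\left(\frac{t+y}2\right)_k\,(2n-2k-1)!\,(2k)!}{\left(\frac{t-y}2+n-k\right)_k}\,\kappa^{\ell+1}.$$ (For $n=1$ the product is empty, equal to $1$.)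
   Context: A walk is a lattice path in $\mathbb Z^2$ with steps $(1,1)$ and $(1,-1)$ never going below the $x$-axis. A family of walks is vicious if no two of its walks share a lattice point. A contact is a lattice point on the $x$-axis lying on one of the walks (starting and end points included); $c(\mathbf P)$ is the total number of contacts of a family $\mathbf P$. $Z^{(n)}_t(y;\kappa)=\sum_{\mathbf P}\kappa^{c(\mathbf P)}$, summed over vicious families $(P_1,\dots,P_n)$ with $P_i$ running from $(0,2i-2)$ to $(t,y+2i-2)$. $(a)_k=a(a+1)\cdots(a+k-1)$, $(a)_0=1$. Binomials: $\binom mk=m(m-1)\cdots(m-k+1)/k!$ for integers $k\ge0$ and $\binom mk=0$ for $k<0$; $1/m!=0$ for negative integers $m$. *)

theory Defs
  imports Complex_Main
begin

type_synonym point = "int \<times> int"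

definition walk_step :: "point \<Rightarrow> point \<Rightarrow> bool" where
  "walk_step p q \<longleftrightarrow> fst q = fst p + 1 \<and> (snd q = snd p + 1 \<or> snd q = snd p - 1)"

(* A walk is the list of the lattice points it visits, in order. *)
definition walk :: "point \<Rightarrow> point \<Rightarrow> point list \<Rightarrow> bool" where
  "walk a b p \<longleftrightarrow>
     p \<noteq> [] \<and> hd p = a \<and> last p = b \<and> successively walk_step p \<and> (\<forall>q\<in>set p. 0 \<le> snd q)"

definition vicious :: "point list list \<Rightarrow> bool" where
  "vicious P \<longleftrightarrow>
     (\<forall>i<length P. \<forall>j<length P. i \<noteq> j \<longrightarrow> set (P ! i) \<inter> set (P ! j) = {})"

definition contacts :: "point list list \<Rightarrow> nat" where
  "contacts P = card {q. snd q = 0 \<and> (\<exists>p\<in>set P. q \<in> set p)}"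

(* List indices start at 0, so P ! i is the (i+1)-st walk of the family. *)
definition vicious_families :: "nat \<Rightarrow> nat \<Rightarrow> nat \<Rightarrow> point list list set" where
  "vicious_families n t y =
     {P. length P = n \<and>
         (\<forall>i<n. walk (0, 2 * int i) (int t, int y + 2 * int i) (P ! i)) \<and>
         vicious P}"

definition Z :: "nat \<Rightarrow> nat \<Rightarrow> nat \<Rightarrow> 'a::field_char_0 \<Rightarrow> 'a" where
  "Z n t y \<kappa> = (\<Sum>P\<in>vicious_families n t y. \<kappa> ^ contacts P)"

(* The upper argument may be negative, and a negative lower argument gives 0. *)
definition binom :: "int \<Rightarrow> int \<Rightarrow> 'a::field_char_0" where
  "binom m k = (if k < 0 then 0 else of_int m gchoose nat k)"

(* 1 / m!, with the convention that it vanishes for negative m. *)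
definition recip_fact :: "int \<Rightarrow> 'a::field_char_0" where
  "recip_fact m = (if m < 0 then 0 else 1 / fact (nat m))"

lemma walk_length_bounds:
  assumes "successively walk_step p" "p \<noteq> []"
  shows "fst (last p) = fst (hd p) + int (length p) - 1"
    and "q \<in> set p \<Longrightarrow> fst (hd p) \<le> fst q \<and> fst q \<le> fst (last p) \<and>
           \<bar>snd q - snd (hd p)\<bar> \<le> fst q - fst (hd p)"
  using assms
proof (induction p)
  case Nil
  { case 1 then show ?case by simp }
  { case 2 then show ?case by simp }
next
  case (Cons a p)
  { case 1 then show ?case
      using Cons.IH(1) by (cases p) (auto simp: walk_step_def) }
  { case 2
    show ?case
    proof (cases p)
      case Nil
      then show ?thesis using 2 by simp
    next
      case (Cons b r)
      have s: "walk_step a b" "successively walk_step p" "p \<noteq> []"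
        using 2 Cons by auto
      have h: "fst (hd p) \<le> fst q' \<and> fst q' \<le> fst (last p) \<and>
           \<bar>snd q' - snd (hd p)\<bar> \<le> fst q' - fst (hd p)" if "q = q'" "q' \<in> set p" for q'
        using Cons.IH(2) s that by blast
      have l: "fst (last p) = fst (hd p) + int (length p) - 1"
        using Cons.IH(1) s by blast
      show ?thesis
      proof (cases "q \<in> set p")
        case True
        then show ?thesis using h[OF refl True] s(1) Cons by (auto simp: walk_step_def)
      next
        case False
        then have "q = a" using 2 by simp
        then show ?thesis using l s(1) Cons by (auto simp: walk_step_def)
      qed
    qed }
qed

lemma finite_walks: "finite {p. walk a b p}"
proof (rule finite_subset)
  let ?S = "{fst a..fst b} \<times> {snd a - (fst b - fst a)..snd a + (fst b - fst a)}"
  let ?k = "nat (fst b - fst a + 1)"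
  show "{p. walk a b p} \<subseteq> {p. set p \<subseteq> ?S \<and> length p = ?k}"
  proof (intro subsetI CollectI conjI)
    fix p assume "p \<in> {p. walk a b p}"
    then have w: "successively walk_step p" "p \<noteq> []" "hd p = a" "last p = b"
      by (auto simp: walk_def)
    show "length p = ?k"
      using walk_length_bounds(1)[OF w(1,2)] w(3,4) by simp
    fix q assume "q \<in> set p"
    from walk_length_bounds(2)[OF w(1,2) this] w(3,4) show "q \<in> ?S"
      by (cases q) auto
  qed
  show "finite {p. set p \<subseteq> ?S \<and> length p = ?k}"
    by (rule finite_lists_length_eq) simp
qed

(* The sum defining Z is therefore a genuine finite sum. *)
lemma finite_vicious_families: "finite (vicious_families n t y)"
proof (rule finite_subset)
  let ?S = "\<Union>i<n. {p. walk (0, 2 * int i) (int t, int y + 2 * int i) p}"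
  show "vicious_families n t y \<subseteq> {P. set P \<subseteq> ?S \<and> length P = n}"
    by (fastforce simp: vicious_families_def in_set_conv_nth)
  show "finite {P. set P \<subseteq> ?S \<and> length P = n}"
    by (rule finite_lists_length_eq) (simp add: finite_walks)
qed

end

(*
  Prepending the forced steps from (-2i, 0) to (0, 2i), the families become vicious families whose
  walks all start on the axis, and a Karlin-McGregor determinant gives
  kappa^(n-1) Z = det [w(t+2i, y+2j)], where w(m, e) is the contact generating function of a single
  walk of length m from 0 to e.  Since w(m, e) + (1 - kappa) w(m, e+2) is kappa times a ballot
  number, row operations remove kappa from all rows but the last.  A weighted alternating sum of the
  columns (an N-th difference, N = n - 1) then annihilates the ballot rows, leaving a product of
  ballot determinants times, for every power of kappa, a single sum over i.  That sum is a balanced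
  terminating 4F3, and Whipple's transformation turns it into the sum over k of the theorem.
*)
theory Submission
  imports Defs "Jordan_Normal_Form.Determinant"
begin

section \<open>Balanced hypergeometric sums\<close>

text \<open>With all starts on the axis, every matrix entry is a value of one function, and the
  start enters only through the length. Each prepended start adds one contact, which is the source
  of \<open>\<kappa> ^ (n - 1)\<close>; the row operations extract the same power, so it cancels.
  This division forces a separate treatment of \<open>\<kappa> = 0\<close>.

  The determinant formula is obtained without a path-switching involution. Determinant and family
  sum, as functions of arbitrary end heights, obey the same last-step recursion and vanish together
  when a height is negative or two heights coincide. End heights share a parity, so distinct ones
  differ by at least 2, and a simultaneous step by 1 or -1 can make them collide but never cross.

  The column weights come from clearing the denominators of the ballot numbers: in row
  \<open>j < N\<close> a polynomial of degree \<open>N - 1\<close> in the column index remains, in a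
  ballot row \<open>N\<close> one simple pole. The pole case, applied at growing size, also
  evaluates the ballot determinants.\<close>

lemma sum_choose_Suc:
  fixes g :: "nat \<Rightarrow> 'a::comm_ring_1"
  shows "(\<Sum>k\<le>Suc n. of_nat (Suc n choose k) * g k) = (\<Sum>k\<le>n. of_nat (n choose k) * (g k + g (Suc k)))"
proof -
  have "(\<Sum>k\<le>Suc n. of_nat (Suc n choose k) * g k)
      = g 0 + (\<Sum>k\<le>n. of_nat (n choose Suc k) * g (Suc k)) + (\<Sum>k\<le>n. of_nat (n choose k) * g (Suc k))"
    unfolding sum.atMost_Suc_shift by (simp add: algebra_simps sum.distrib)
  also have "g 0 + (\<Sum>k\<le>n. of_nat (n choose Suc k) * g (Suc k)) = (\<Sum>k\<le>Suc n. of_nat (n choose k) * g k)"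
    unfolding sum.atMost_Suc_shift by simp
  also have "\<dots> = (\<Sum>k\<le>n. of_nat (n choose k) * g k)"
    by (simp add: binomial_eq_0)
  finally show ?thesis
    by (simp add: algebra_simps sum.distrib)
qed

text \<open>The absorption \<open>Suc k * (n choose Suc k) = (n - k) * (n choose k)\<close> followed
  by an index shift. In the Pfaff-Saalschuetz induction it returns terms at \<open>Suc k\<close> to
  index \<open>k\<close>.\<close>

lemma sum_choose_absorb:
  fixes g :: "nat \<Rightarrow> 'a::comm_ring_1"
  shows "(\<Sum>k\<le>n. of_nat (n choose k) * of_nat k * g k) =
         (\<Sum>k\<le>n. of_nat (n choose k) * of_nat (n - k) * g (Suc k))"
proof (cases n)
  case 0
  then show ?thesis by simp
next
  case (Suc m)
  have *: "Suc k * (Suc m choose Suc k) = (Suc m - k) * (Suc m choose k)" if "k \<le> m" for k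
    using that by (metis Suc_times_binomial binomial_absorb_comp diff_Suc_1)
  have "(\<Sum>k\<le>n. of_nat (n choose k) * of_nat k * g k) =
        (\<Sum>k\<le>m. of_nat (Suc k * (Suc m choose Suc k)) * g (Suc k))"
    unfolding Suc sum.atMost_Suc_shift of_nat_mult by (simp add: mult_ac)
  also have "\<dots> = (\<Sum>k\<le>m. of_nat ((Suc m - k) * (Suc m choose k)) * g (Suc k))"
    by (intro sum.cong refl) (metis * atMost_iff)
  also have "\<dots> = (\<Sum>k\<le>n. of_nat (n choose k) * of_nat (n - k) * g (Suc k))"
    unfolding Suc by (simp add: mult_ac)
  finally show ?thesis .
qed

lemma pochhammer_shift:
  fixes e :: "'a::comm_ring_1"
  shows "pochhammer e m = pochhammer (e + 1) m - of_nat m * pochhammer (e + 1) (m - 1)"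
proof (cases m)
  case (Suc k)
  then show ?thesis
    by (simp only: pochhammer_rec[of e] pochhammer_Suc[of "e + 1"]) (simp add: algebra_simps)
qed simp

text \<open>The Pfaff--Saalschuetz sum, multiplied by \<open>pochhammer c n\<close> so that it is a
  polynomial identity; below, \<open>c\<close> is a nonpositive integer.\<close>

lemma pfaff_saalschuetz:
  fixes a b c :: "'a::comm_ring_1"
  shows "pochhammer (c - a) n * pochhammer (c - b) n =
    (\<Sum>k\<le>n. of_nat (n choose k) * (pochhammer a k * pochhammer b k *
       pochhammer (c + of_nat k) (n - k) * pochhammer (c - a - b) (n - k)))"
proof (induction n arbitrary: c)
  case 0
  then show ?case by simp
next
  case (Suc n)
  define e where "e = c - a - b"
  define T where "T k = pochhammer a k * pochhammer b k" for k
  \<comment> \<open>\<open>X\<close> is the summand of the induction hypothesis at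
    \<open>c + 1\<close>, where the difference \<open>c - a - b\<close> becomes
    \<open>e + 1\<close>. \<open>g\<close> is the summand to be treated, and \<open>h\<close>
    differs from it only in the last Pochhammer symbol. After Pascal and absorption everything is a
    multiple of \<open>X k\<close>, with coefficient \<open>(c + k) * e + (a + k) * (b + k) - k * (c
    + k) = (c - a) * (c - b)\<close>.\<close>
  define X where "X k = T k * pochhammer (c + 1 + of_nat k) (n - k) * pochhammer (e + 1) (n - k)" for k
  define g where "g k = T k * pochhammer (c + of_nat k) (Suc n - k) * pochhammer e (Suc n - k)" for k
  define h where "h k = T k * pochhammer (c + of_nat k) (Suc n - k) * pochhammer (e + 1) (n - k)" for k
  have T_Suc: "T (Suc k) = (a + of_nat k) * (b + of_nat k) * T k" for k
    by (simp add: T_def pochhammer_Suc)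
  have g0: "g k = (c + of_nat k) * e * X k" if "k \<le> n" for k
    using that by (simp add: g_def X_def Suc_diff_le pochhammer_rec algebra_simps)
  have h0: "h k = (c + of_nat k) * X k" if "k \<le> n" for k
    using that by (simp add: h_def X_def Suc_diff_le pochhammer_rec algebra_simps)
  have g1: "g (Suc k) = (a + of_nat k) * (b + of_nat k) * X k - of_nat (n - k) * h (Suc k)" for k
    unfolding g_def h_def X_def T_Suc
    by (subst (2) pochhammer_shift) (simp add: algebra_simps)
  have "(\<Sum>k\<le>Suc n. of_nat (Suc n choose k) * g k)
      = (\<Sum>k\<le>n. of_nat (n choose k) * (g k + (a + of_nat k) * (b + of_nat k) * X k))
        - (\<Sum>k\<le>n. of_nat (n choose k) * of_nat (n - k) * h (Suc k))"
    unfolding sum_choose_Suc g1 by (simp add: algebra_simps sum.distrib sum_subtractf)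
  also have "\<dots> = (\<Sum>k\<le>n. of_nat (n choose k) * (g k + (a + of_nat k) * (b + of_nat k) * X k))
        - (\<Sum>k\<le>n. of_nat (n choose k) * of_nat k * h k)"
    unfolding sum_choose_absorb[of n h] ..
  also have "\<dots> = (\<Sum>k\<le>n. of_nat (n choose k) * ((c - a) * (c - b) * X k))"
    unfolding sum_subtractf[symmetric]
    by (intro sum.cong refl) (simp add: g0 h0 e_def algebra_simps)
  also have "\<dots> = (c - a) * (c - b) * (\<Sum>k\<le>n. of_nat (n choose k) * X k)"
    by (simp add: sum_distrib_left mult_ac)
  also have "(\<Sum>k\<le>n. of_nat (n choose k) * X k) = pochhammer (c + 1 - a) n * pochhammer (c + 1 - b) n"
    unfolding Suc.IH X_def T_def e_def by (simp add: algebra_simps)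
  finally show ?case
    by (simp add: g_def T_def e_def pochhammer_rec algebra_simps)
qed

text \<open>The terminating series 4F3(-n, a, b, 1-f-n; c, 1-f+d-n, 1-f+e-n; 1) times (c)_n (f-d)_n
  (f-e)_n, written without denominators. Its Saalschuetz condition is
  \<open>c - a - b = f - d - e\<close>.\<close>

definition whipple_sum :: "nat \<Rightarrow> 'a::comm_ring_1 \<Rightarrow> 'a \<Rightarrow> 'a \<Rightarrow> 'a \<Rightarrow> 'a \<Rightarrow> 'a \<Rightarrow> 'a" where
  "whipple_sum n a b c d e f = (\<Sum>k\<le>n. of_nat (n choose k) *
     (pochhammer a k * pochhammer b k * pochhammer (c + of_nat k) (n - k) *
      (pochhammer (f - d) (n - k) * pochhammer (f - e) (n - k)) * pochhammer (f + of_nat (n - k)) k))"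

text \<open>Both sides expand by Pfaff--Saalschuetz into the same double sum, which is symmetric
  under exchanging \<open>(a, b, c)\<close> and \<open>(d, e, f)\<close>.\<close>

lemma whipple:
  fixes a b c d e f :: "'a::comm_ring_1"
  assumes balanced: "c - a - b = f - d - e"
  shows "whipple_sum n a b c d e f = whipple_sum n d e f a b c"
proof -
  define Q where "Q a b c d e f k r =
     of_nat (n choose k) * of_nat (n - k choose r) * (pochhammer a k * pochhammer b k * (pochhammer d r * pochhammer e r) *
     pochhammer (f - d - e) (n - k - r) * pochhammer (c + of_nat k) (n - k) * pochhammer (f + of_nat r) (n - r))"
     for a b c d e f :: 'a and k r
  have W_eq: "whipple_sum n a b c d e f = (\<Sum>k\<le>n. \<Sum>r\<le>n - k. Q a b c d e f k r)" for a b c d e f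
    unfolding whipple_sum_def pfaff_saalschuetz sum_distrib_left sum_distrib_right
  proof (intro sum.cong refl)
    fix k r assume "k \<in> {..n}" "r \<in> {..n - k}"
    then have "of_nat r + of_nat (n - k - r) = (of_nat (n - k) :: 'a)"
      using \<open>k \<in> _\<close> \<open>r \<in> _\<close> by (simp del: of_nat_diff add: of_nat_add[symmetric])
    \<comment> \<open>The two adjacent ranges of factors join into one Pochhammer symbol, the exact
      counterpart of \<open>pochhammer (c + of_nat k) (n - k)\<close>; this is what makes
      \<open>Q\<close> symmetric.\<close>
    then have "pochhammer (f + of_nat r) (n - r)
        = pochhammer (f + of_nat r) (n - k - r) * pochhammer (f + of_nat (n - k)) k"
      using pochhammer_product'[of "f + of_nat r" "n - k - r" k]
      using \<open>k \<in> _\<close> \<open>r \<in> _\<close> by (simp add: add.assoc)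
    then show "of_nat (n choose k) * (pochhammer a k * pochhammer b k * pochhammer (c + of_nat k) (n - k) *
       (of_nat (n - k choose r) * (pochhammer d r * pochhammer e r * pochhammer (f + of_nat r) (n - k - r) *
         pochhammer (f - d - e) (n - k - r))) * pochhammer (f + of_nat (n - k)) k) = Q a b c d e f k r"
      by (simp add: Q_def mult_ac)
  qed
  have swap: "(n choose k) * (n - k choose r) = (n choose r) * (n - r choose k)" if "k + r \<le> n" for k r
    using choose_mult[of k "k + r" n] choose_mult[of r "k + r" n] that binomial_symmetric[of k "k + r"]
    by simp
  have Q_swap: "Q a b c d e f k r = Q d e f a b c r k" if "k + r \<le> n" for k r
    using arg_cong[OF swap[OF that], of "of_nat :: _ \<Rightarrow> 'a"]
    by (simp add: Q_def balanced mult_ac add.commute[of r k])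
  have "whipple_sum n a b c d e f = (\<Sum>k\<le>n. \<Sum>r | r \<in> {..n} \<and> k + r \<le> n. Q a b c d e f k r)"
    unfolding W_eq by (intro sum.cong) auto
  also have "\<dots> = (\<Sum>r\<le>n. \<Sum>k | k \<in> {..n} \<and> k + r \<le> n. Q a b c d e f k r)"
    by (rule sum.swap_restrict) auto
  also have "\<dots> = whipple_sum n d e f a b c"
    unfolding W_eq by (intro sum.cong) (auto simp: Q_swap)
  finally show ?thesis .
qed

section \<open>Alternating binomial sums\<close>

text \<open>An \<open>n\<close>-th difference kills polynomials of degree below \<open>n\<close>.
  The last factor is split into its two summands: \<open>a k\<close> leaves a product with one
  factor fewer, and \<open>of_nat i\<close> is absorbed into the binomial, which lowers
  \<open>n\<close> as well.\<close>

lemma sum_alt_choose_poly: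
  fixes a :: "nat \<Rightarrow> 'a::comm_ring_1"
  assumes "k < n"
  shows "(\<Sum>i\<le>n. (-1) ^ i * of_nat (n choose i) * (\<Prod>r<k. of_nat i + a r)) = 0"
  using assms
proof (induction k arbitrary: n a)
  case 0
  then show ?case using choose_alternating_sum[of n, where ?'a = 'a] by simp
next
  case (Suc k)
  then obtain m where n: "n = Suc m" and m: "k < m"
    by (cases n) auto
  define g where "g i = (\<Prod>r<k. of_nat i + a r)" for i :: nat
  have "(\<Sum>i\<le>n. (-1) ^ i * of_nat (n choose i) * (of_nat i * g i))
      = (\<Sum>i\<le>m. (-1) ^ Suc i * of_nat (Suc i * (Suc m choose Suc i)) * g (Suc i))"
    unfolding n sum.atMost_Suc_shift by (simp add: algebra_simps del: binomial_Suc_Suc)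
  also have "\<dots> = - of_nat n * (\<Sum>i\<le>m. (-1) ^ i * of_nat (m choose i) * (\<Prod>r<k. of_nat i + (a r + 1)))"
    unfolding Suc_times_binomial n of_nat_mult
    by (simp add: g_def sum_distrib_left mult_ac add_ac del: of_nat_Suc flip: sum_negf)
       (simp add: mult_ac add_ac)
  also have "\<dots> = 0"
    unfolding Suc.IH[OF m] by simp
  finally have 1: "(\<Sum>i\<le>n. (-1) ^ i * of_nat (n choose i) * (of_nat i * g i)) = 0" .
  have 2: "(\<Sum>i\<le>n. (-1) ^ i * of_nat (n choose i) * g i) = 0"
    unfolding g_def using Suc.prems by (intro Suc.IH) simp
  have "(\<Sum>i\<le>n. (-1) ^ i * of_nat (n choose i) * (\<Prod>r<Suc k. of_nat i + a r))
     = (\<Sum>i\<le>n. (-1) ^ i * of_nat (n choose i) * (of_nat i * g i))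
       + (\<Sum>i\<le>n. (-1) ^ i * of_nat (n choose i) * g i) * a k"
    unfolding g_def prod.lessThan_Suc sum_distrib_right
    by (simp add: algebra_simps flip: sum.distrib)
  then show ?case using 1 2 by simp
qed

text \<open>The \<open>n\<close>-th difference of a simple pole. By Pascal's rule, passing to
  \<open>Suc n\<close> subtracts the value at \<open>\<alpha> + 1\<close> from that at
  \<open>\<alpha>\<close>.\<close>

lemma sum_alt_choose_inverse:
  fixes \<alpha> :: "'a::field_char_0"
  assumes "\<And>i. i \<le> n \<Longrightarrow> of_nat i + \<alpha> \<noteq> 0"
  shows "(\<Sum>i\<le>n. (-1) ^ i * of_nat (n choose i) / (of_nat i + \<alpha>)) = fact n / pochhammer \<alpha> (Suc n)"
  using assms
proof (induction n arbitrary: \<alpha>)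
  case (Suc n)
  have nz0: "of_nat i + (\<alpha> + 1) \<noteq> 0" if "i \<le> n" for i
    using Suc.prems[of "Suc i"] that by (simp add: add_ac)
  have nz: "pochhammer (\<alpha> + 1) n \<noteq> 0" "\<alpha> \<noteq> 0" "\<alpha> + 1 + of_nat n \<noteq> 0"
    using Suc.prems[of 0] nz0[of n] nz0[of "_ :: nat"]
    by (auto simp: pochhammer_eq_0_iff add.commute[of _ "\<alpha> + 1"] simp del: of_nat_eq_iff)
       (metis less_imp_le)
  have IH: "(\<Sum>i\<le>n. (-1) ^ i * of_nat (n choose i) / (of_nat i + \<beta>)) = fact n / pochhammer \<beta> (Suc n)"
    if "\<beta> = \<alpha> \<or> \<beta> = \<alpha> + 1" for \<beta>
    using that nz0 Suc.prems by (intro Suc.IH) auto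
  have "(\<Sum>i\<le>Suc n. (-1) ^ i * of_nat (Suc n choose i) / (of_nat i + \<alpha>))
      = (\<Sum>i\<le>Suc n. of_nat (Suc n choose i) * ((-1) ^ i / (of_nat i + \<alpha>)))"
    by (simp add: mult_ac)
  also have "\<dots> = (\<Sum>i\<le>n. (-1) ^ i * of_nat (n choose i) / (of_nat i + \<alpha>))
       - (\<Sum>i\<le>n. (-1) ^ i * of_nat (n choose i) / (of_nat i + (\<alpha> + 1)))"
    unfolding sum_choose_Suc sum_subtractf[symmetric] by (intro sum.cong) (simp_all add: algebra_simps)
  also have "\<dots> = fact n / pochhammer \<alpha> (Suc n) - fact n / pochhammer (\<alpha> + 1) (Suc n)"
    by (simp only: IH[OF disjI1[OF refl]] IH[OF disjI2[OF refl]])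
  also have "\<dots> = fact (Suc n) / pochhammer \<alpha> (Suc (Suc n))"
  proof -
    have "x / (a * p) - x / (p * b) = (b - a) * x / (a * (p * b))"
      if "a \<noteq> 0" "p \<noteq> 0" "b \<noteq> 0" for x a p b :: 'a
      using that by (simp add: field_simps)
    from this[OF nz(2,1,3)] show ?thesis
      unfolding pochhammer_rec[of \<alpha>] pochhammer_Suc[of "\<alpha> + 1"] by simp
  qed
  finally show ?case .
qed simp

text \<open>Polynomial division by \<open>of_nat i + \<alpha>\<close>: the quotient has degree below
  \<open>n\<close> and is annihilated, so only the remainder counts, which is the numerator
  evaluated at \<open>- \<alpha>\<close>.\<close>

lemma sum_alt_choose_quotient:
  fixes \<alpha> :: "'a::field_char_0"
  assumes "\<And>i. i \<le> n \<Longrightarrow> of_nat i + \<alpha> \<noteq> 0" and "k \<le> n"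
  shows "(\<Sum>i\<le>n. (-1) ^ i * of_nat (n choose i) * (\<Prod>r<k. of_nat i + a r) / (of_nat i + \<alpha>))
    = (\<Prod>r<k. a r - \<alpha>) * fact n / pochhammer \<alpha> (Suc n)"
  using assms(2)
proof (induction k)
  case 0
  then show ?case using sum_alt_choose_inverse[OF assms(1)] by simp
next
  case (Suc k)
  have "(\<Sum>i\<le>n. (-1) ^ i * of_nat (n choose i) * (\<Prod>r<Suc k. of_nat i + a r) / (of_nat i + \<alpha>))
    = (\<Sum>i\<le>n. (-1) ^ i * of_nat (n choose i) * (\<Prod>r<k. of_nat i + a r)
        + (a k - \<alpha>) * ((-1) ^ i * of_nat (n choose i) * (\<Prod>r<k. of_nat i + a r) / (of_nat i + \<alpha>)))"
  proof (intro sum.cong refl)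
    fix i assume "i \<in> {..n}"
    then have "of_nat i + \<alpha> \<noteq> 0" using assms(1) by simp
    then have "(of_nat i + a k) / (of_nat i + \<alpha>) = 1 + (a k - \<alpha>) / (of_nat i + \<alpha>)"
      by (simp add: divide_simps)
    moreover have "x * (p * u) / v = x * p * (u / v)" for x p u v :: 'a by simp
    moreover have "x * (1 + c / v) = x + c * (x / v)" for x c v :: 'a by (simp add: algebra_simps)
    ultimately show "(-1) ^ i * of_nat (n choose i) * (\<Prod>r<Suc k. of_nat i + a r) / (of_nat i + \<alpha>) =
      (-1) ^ i * of_nat (n choose i) * (\<Prod>r<k. of_nat i + a r)
        + (a k - \<alpha>) * ((-1) ^ i * of_nat (n choose i) * (\<Prod>r<k. of_nat i + a r) / (of_nat i + \<alpha>))"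
      by (simp only: prod.lessThan_Suc)
  qed
  also have "\<dots> = (a k - \<alpha>) * (\<Sum>i\<le>n. (-1) ^ i * of_nat (n choose i) * (\<Prod>r<k. of_nat i + a r) / (of_nat i + \<alpha>))"
    using sum_alt_choose_poly[of k n a] Suc.prems by (simp add: sum.distrib sum_distrib_left)
  finally show ?case using Suc by simp
qed

section \<open>Contact generating function of a single walk\<close>

primrec wcount :: "'a::field_char_0 \<Rightarrow> nat \<Rightarrow> int \<Rightarrow> 'a" where
  "wcount \<kappa> 0 e = (if e = 0 then \<kappa> else 0)"
| "wcount \<kappa> (Suc m) e =
     (if e < 0 then 0 else (if e = 0 then \<kappa> else 1) * (wcount \<kappa> m (e - 1) + wcount \<kappa> m (e + 1)))"

lemma wcount_neg: "e < 0 \<Longrightarrow> wcount \<kappa> m e = 0"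
  by (cases m) auto

lemma wcount_above: "int m < e \<Longrightarrow> wcount \<kappa> m e = 0"
  by (induction m arbitrary: e) auto

lemma wcount_top: "wcount \<kappa> m (int m) = \<kappa>"
  by (induction m) (auto simp: wcount_above)

text \<open>Above the axis both sides obey the same linear recursion. At \<open>e = 0\<close> the
  contact weight cancels: \<open>\<kappa> * x + (1 - \<kappa>) * (x + z) = x + (1 - \<kappa>) *
  z\<close>, the same combination at height 1. So the weight \<open>\<kappa>\<close> survives only
  from the starting point.\<close>

lemma wcount_elim:
  "e \<ge> 0 \<Longrightarrow> wcount \<kappa> m e + (1 - \<kappa>) * wcount \<kappa> m (e + 2) = \<kappa> * wcount 1 m e"
proof (induction m arbitrary: e)
  case (Suc m)
  show ?case
  proof (cases "e = 0")
    case True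
    have "\<kappa> * x + (1 - \<kappa>) * (x + z) = x + (1 - \<kappa>) * z" for x z
      by (simp add: algebra_simps)
    then show ?thesis using Suc.IH[of 1] True
      by (simp add: wcount_neg)
  next
    case False
    have "x + y + (1 - \<kappa>) * (y + z) = (x + (1 - \<kappa>) * y) + (y + (1 - \<kappa>) * z)" for x y z
      by (simp add: algebra_simps)
    then show ?thesis using Suc.IH[of "e - 1"] Suc.IH[of "e + 1"] Suc.prems False
      by (simp add: ac_simps) (simp add: algebra_simps)
  qed
qed simp

text \<open>At \<open>\<kappa> = 1\<close> walks are merely counted, which gives the ballot numbers.
  Indexing by the number \<open>h\<close> of down-steps builds in the parity condition.\<close>

lemma ballot_closed_form:
  "wcount 1 (2 * h + e) (int e) = (fact (2 * h + e) * of_nat (Suc e) / (fact h * fact (Suc (h + e))) :: 'a::field_char_0)"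
proof (induction "2 * h + e" arbitrary: h e)
  case (Suc m)
  show ?case
  proof (cases e)
    case 0
    then obtain g where h: "h = Suc g" using Suc(2) by (cases h) auto
    have m: "m = 2 * g + 1" using Suc(2) 0 h by simp
    have "2 * h + e = Suc (2 * g + 1)" using 0 h by simp
    then have "wcount (1::'a) (2 * h + e) (int e) = wcount 1 (2 * g + 1) (int 1)"
      unfolding 0 by (simp only: wcount.simps) (simp add: wcount_neg del: wcount.simps)
    also have "\<dots> = fact (2 * g + 1) * 2 / (fact g * fact (g + 2))"
      using Suc(1)[OF m] by simp
    finally have *: "wcount (1::'a) (2 * h + e) (int e) = fact (2 * g + 1) * 2 / (fact g * fact (g + 2))" .
    have "x * 2 / (p * q) = of_nat (2 * Suc g) * x / ((of_nat (Suc g) * p) * q)" for x p q :: 'a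
      unfolding of_nat_mult by (simp del: of_nat_Suc)
    from this[of "fact (2 * g + 1)" "fact g" "fact (g + 2)"] show ?thesis
      unfolding * by (simp add: h 0 del: of_nat_Suc of_nat_mult of_nat_add)
  next
    case e: (Suc e')
    have "wcount (1::'a) (2 * h + e) (int e) = wcount 1 m (int e') + wcount 1 m (int (e + 1))"
      using Suc(2) e by (simp add: add.commute flip: Suc(2))
    moreover have "wcount (1::'a) m (int e') = fact m * of_nat e / (fact h * fact (h + e))"
      using Suc(1)[of h e'] Suc(2) e by simp
    \<comment> \<open>The closed form at \<open>h - 1\<close>, multiplied through by
      \<open>of_nat h\<close> so that it also gives the value 0 at \<open>h = 0\<close>, where the
      height is out of reach.\<close>
    moreover have "wcount (1::'a) m (int (e + 1)) = of_nat h * fact m * of_nat (e + 2) / (fact h * fact (Suc (h + e)))"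
    proof (cases h)
      case 0
      then show ?thesis using Suc(2) by (simp add: wcount_above)
    next
      case (Suc g)
      then have "m = 2 * g + (e + 1)" using \<open>Suc m = 2 * h + e\<close> by simp
      from Suc.hyps(1)[OF this]
      have "wcount (1::'a) m (int (e + 1)) = fact m * of_nat (e + 2) / (fact g * fact (Suc (h + e)))"
        unfolding \<open>m = _\<close>[symmetric] using Suc by simp
      also have "\<dots> = of_nat (Suc g) * fact m * of_nat (e + 2) / ((of_nat (Suc g) * fact g) * fact (Suc (h + e)))"
        by (simp del: of_nat_Suc of_nat_add fact_Suc)
      finally show ?thesis unfolding Suc fact_Suc[of g] .
    qed
    moreover have "of_nat (Suc m) = (2 * of_nat h + of_nat e :: 'a)"
      unfolding Suc(2) by simp
    then have "x * of_nat e / (p * q) + of_nat h * x * of_nat (e + 2) / (p * (of_nat (Suc (h + e)) * q)) =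
        of_nat (Suc m) * x * of_nat (Suc e) / (p * (of_nat (Suc (h + e)) * q))"
        if "p \<noteq> 0" "q \<noteq> 0" for x p q :: 'a
      using that of_nat_neq_0[of "h + e", where ?'a = 'a]
      by (simp add: divide_simps del: of_nat_Suc) (simp add: algebra_simps)
    note this[of "fact h" "fact (h + e)" "fact m"]
    ultimately show ?thesis
      unfolding Suc(2)[symmetric] by (simp only: fact_Suc[of m] fact_Suc[of "h + e"] fact_nonzero) simp
  qed
qed simp

text \<open>\<open>wcoef h e l\<close> counts the walks from height 0 to \<open>e\<close> with \<open>h\<close> down-steps and \<open>l + 1\<close> contacts.
  For \<open>h = e = l = 0\<close> it is 0 instead of 1.\<close>

definition wcoef :: "nat \<Rightarrow> nat \<Rightarrow> nat \<Rightarrow> 'a::field_char_0" where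
  "wcoef h e l = (if l \<le> h then fact (2 * h + e - l - 1) * of_nat (e + l) / (fact (h - l) * fact (h + e)) else 0)"

lemma wcoef_diag:
  assumes "h + e > 0"
  shows "wcoef h e h = (1::'a::field_char_0)"
proof -
  obtain k where k: "h + e = Suc k" using assms by (cases "h + e") auto
  then have "2 * h + e - h - 1 = k" "e + h = Suc k" by simp_all
  then show ?thesis
    unfolding wcoef_def by (simp only: k fact_Suc) (simp del: of_nat_Suc)
qed

text \<open>The last step goes up from height \<open>e\<close>, or down from \<open>e + 2\<close>
  with one down-step fewer before it; ending above the axis, it adds no contact. The hypothesis
  excludes the empty walk, for which \<open>wcoef 0 0 0 = 0\<close> is not the true count.\<close>

lemma wcoef_Suc:
  assumes "2 * h + e > 0"
  shows "wcoef h (Suc e) l = (wcoef h e l + (case h of 0 \<Rightarrow> 0 | Suc g \<Rightarrow> wcoef g (e + 2) l) :: 'a::field_char_0)"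
proof (cases h)
  case 0
  then show ?thesis using assms of_nat_neq_0[of e, where ?'a = 'a]
    by (cases e) (auto simp: wcoef_def simp del: of_nat_Suc)
next
  case (Suc g)
  consider "l \<le> g" | "l = h" | "l > h" using Suc by linarith
  then show ?thesis
  proof cases
    case 1
    then obtain r where g: "g = l + r" using le_Suc_ex by blast
    define q where "q = Suc (2 * r + l + e)"
    have nat_eqs: "2 * h + Suc e - l - 1 = Suc q" "2 * h + e - l - 1 = q" "2 * g + (e + 2) - l - 1 = q"
      "h - l = Suc r" "g - l = r" "h + Suc e = Suc (h + e)" "g + (e + 2) = Suc (h + e)"
      by (simp_all add: q_def g Suc)
    have "of_nat (Suc q) * x * of_nat (Suc e + l) / (of_nat (Suc r) * y * (of_nat (Suc (h + e)) * z))
       = x * of_nat (e + l) / (of_nat (Suc r) * y * z) + x * of_nat (e + 2 + l) / (y * (of_nat (Suc (h + e)) * z))"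
      if "y \<noteq> 0" "z \<noteq> 0" for x y z :: 'a
      using that of_nat_neq_0[of "h + e", where ?'a = 'a] of_nat_neq_0[of r, where ?'a = 'a]
      by (simp add: divide_simps del: of_nat_Suc) (simp add: algebra_simps q_def g Suc)
    note * = this[of "fact r" "fact (h + e)" "fact q", OF fact_nonzero fact_nonzero]
    have "(case h of 0 \<Rightarrow> 0 | Suc g \<Rightarrow> wcoef g (e + 2) l) = (wcoef g (e + 2) l :: 'a)" "l \<le> h"
      using 1 Suc by simp_all
    with 1 * show ?thesis
      by (simp only: wcoef_def nat_eqs if_True fact_Suc[of q] fact_Suc[of r] fact_Suc[of "h + e"])
  next
    case 2
    then show ?thesis using wcoef_diag[of h e, where ?'a = 'a] wcoef_diag[of h "Suc e", where ?'a = 'a] Suc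
      by (simp add: wcoef_def[of g])
  qed (use Suc in \<open>simp add: wcoef_def\<close>)
qed

lemma wcoef_0:
  assumes "h > 0"
  shows "wcoef h 0 0 = (0::'a::field_char_0)" "wcoef h 0 (Suc l) = (wcoef (h - 1) 1 l ::'a)"
  using assms by (cases h; simp add: wcoef_def)+

lemma wcount_closed_form:
  assumes "2 * h + e > 0"
  shows "wcount \<kappa> (2 * h + e) (int e) = (\<Sum>l\<le>h. wcoef h e l * \<kappa> ^ Suc l)"
  using assms
proof (induction "2 * h + e" arbitrary: h e)
  case (Suc m)
  show ?case
  proof (cases e)
    case 0
    then obtain g where h: "h = Suc g" using Suc(2) by (cases h) auto
    have m: "m = 2 * g + 1" using Suc(2) 0 h by simp
    have "2 * h + e = Suc (2 * g + 1)" using 0 h by simp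
    then have "wcount \<kappa> (2 * h + e) (int e) = \<kappa> * wcount \<kappa> (2 * g + 1) (int 1)"
      unfolding 0 by (simp only: wcount.simps) (simp add: wcount_neg del: wcount.simps)
    also have "\<dots> = \<kappa> * (\<Sum>l\<le>g. wcoef g 1 l * \<kappa> ^ Suc l)"
      using Suc(1)[OF m] by simp
    also have "\<dots> = (\<Sum>l\<le>h. wcoef h e l * \<kappa> ^ Suc l)"
      unfolding h sum.atMost_Suc_shift 0 by (simp add: wcoef_0 sum_distrib_left mult_ac)
    finally show ?thesis .
  next
    case e: (Suc e')
    show ?thesis
    proof (cases "m = 0")
      \<comment> \<open>Walks of length 1: their predecessor is the empty walk, which the induction
        hypothesis does not cover.\<close>
      case True
      then show ?thesis using e Suc(2) by (simp add: wcoef_def)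
    next
      case False
      have "wcount \<kappa> (2 * h + e) (int e) = wcount \<kappa> m (int e') + wcount \<kappa> m (int (e + 1))"
        unfolding Suc(2)[symmetric] by (simp add: e add.commute)
      moreover have "wcount \<kappa> m (int e') = (\<Sum>l\<le>h. wcoef h e' l * \<kappa> ^ Suc l)"
        using Suc(1)[of h e'] Suc(2) e False by simp
      moreover have "wcount \<kappa> m (int (e + 1))
           = (\<Sum>l\<le>h. (case h of 0 \<Rightarrow> 0 | Suc g \<Rightarrow> wcoef g (e' + 2) l) * \<kappa> ^ Suc l)"
      proof (cases h)
        case 0
        then show ?thesis using Suc(2) by (simp add: wcount_above)
      next
        case (Suc g)
        then have "m = 2 * g + (e + 1)" using \<open>Suc m = 2 * h + e\<close> by simp
        from Suc.hyps(1)[OF this] this Suc show ?thesis by (simp add: e wcoef_def)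
      qed
      ultimately show ?thesis
        using False Suc(2) e
        by (simp add: wcoef_Suc[of h e'] algebra_simps sum.distrib)
    qed
  qed
qed simp

section \<open>The determinant formula\<close>

text \<open>Row \<open>j\<close> belongs to the end point \<open>e j\<close>; column \<open>i\<close> to the walk starting at \<open>(- 2 i, 0)\<close>.\<close>

definition wdet :: "'a::field_char_0 \<Rightarrow> nat \<Rightarrow> nat \<Rightarrow> (nat \<Rightarrow> int) \<Rightarrow> 'a" where
  "wdet \<kappa> n t e = det (mat n n (\<lambda>(j, i). wcount \<kappa> (t + 2 * i) (e j)))"

lemma wdet_leibniz:
  "wdet \<kappa> n t e = (\<Sum>p | p permutes {0..<n}. signof p * (\<Prod>j\<in>{0..<n}. wcount \<kappa> (t + 2 * p j) (e j)))"
  unfolding wdet_def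
  by (subst det_def'[of _ n]) (auto intro!: sum.cong prod.cong dest: permutes_in_image)

text \<open>In row \<open>j\<close>, the contact weight and the two possible predecessors of
  \<open>e j\<close> do not depend on the column. Hence the weight leaves the row, and
  multilinearity expands the determinant over all choices of predecessors.\<close>

lemma wdet_Suc:
  assumes "\<And>j. j < n \<Longrightarrow> 0 \<le> e j"
  shows "wdet \<kappa> n (Suc t) e = (\<Prod>j\<in>{0..<n}. if e j = 0 then \<kappa> else 1) *
           (\<Sum>e'\<in>PiE {0..<n} (\<lambda>j. {e j - 1, e j + 1}). wdet \<kappa> n t e')"
proof -
  have "(\<Prod>j\<in>{0..<n}. wcount \<kappa> (Suc t + 2 * p j) (e j)) = (\<Prod>j\<in>{0..<n}. if e j = 0 then \<kappa> else 1) *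
       (\<Sum>e'\<in>PiE {0..<n} (\<lambda>j. {e j - 1, e j + 1}). \<Prod>j\<in>{0..<n}. wcount \<kappa> (t + 2 * p j) (e' j))" for p
  proof -
    have "(\<Prod>j\<in>{0..<n}. wcount \<kappa> (Suc t + 2 * p j) (e j)) =
       (\<Prod>j\<in>{0..<n}. (if e j = 0 then \<kappa> else 1) * (\<Sum>x\<in>{e j - 1, e j + 1}. wcount \<kappa> (t + 2 * p j) x))"
      using assms by (intro prod.cong refl) (force simp: not_less)
    also have "\<dots> = (\<Prod>j\<in>{0..<n}. if e j = 0 then \<kappa> else 1) *
         (\<Prod>j\<in>{0..<n}. \<Sum>x\<in>{e j - 1, e j + 1}. wcount \<kappa> (t + 2 * p j) x)"
      by (rule prod.distrib)
    also have "(\<Prod>j\<in>{0..<n}. \<Sum>x\<in>{e j - 1, e j + 1}. wcount \<kappa> (t + 2 * p j) x) =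
         (\<Sum>e'\<in>PiE {0..<n} (\<lambda>j. {e j - 1, e j + 1}). \<Prod>j\<in>{0..<n}. wcount \<kappa> (t + 2 * p j) (e' j))"
      by (rule prod_sum_PiE) auto
    finally show ?thesis .
  qed
  then show ?thesis
    unfolding wdet_leibniz
    by (simp only: sum_distrib_left mult.left_commute) (rule sum.swap)
qed

text \<open>With \<open>wdet_eq\<close>, the boundary values of the recursion;
  \<open>families_neg\<close> and \<open>families_eq\<close> are their counterparts for families.
  They remove the inadmissible choices of predecessors.\<close>

lemma wdet_neg:
  assumes "j < n" "e j < 0"
  shows "wdet \<kappa> n t e = 0"
  unfolding wdet_leibniz using assms
  by (intro sum.neutral ballI) (auto intro!: bexI[of _ j] simp: wcount_neg)

lemma wdet_eq:
  assumes "i < n" "j < n" "i \<noteq> j" "e i = e j"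
  shows "wdet \<kappa> n t e = 0"
  unfolding wdet_def
  by (rule det_identical_rows[OF _ assms(3,1,2)]) (use assms in \<open>auto simp: row_def\<close>)

section \<open>Vicious families with arbitrary end heights and their last-step recursion\<close>

definition families :: "nat \<Rightarrow> nat \<Rightarrow> (nat \<Rightarrow> int) \<Rightarrow> point list list set" where
  "families n t e = {P. length P = n \<and>
     (\<forall>i<n. walk (0, 2 * int i) (int t, e i) (P ! i)) \<and> vicious P}"

definition wsum :: "'a::field_char_0 \<Rightarrow> nat \<Rightarrow> nat \<Rightarrow> (nat \<Rightarrow> int) \<Rightarrow> 'a" where
  "wsum \<kappa> n t e = (\<Sum>P\<in>families n t e. \<kappa> ^ contacts P)"

lemma finite_families: "finite (families n t e)"
proof (rule finite_subset)
  let ?S = "\<Union>i<n. {p. walk (0, 2 * int i) (int t, e i) p}"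
  show "families n t e \<subseteq> {P. set P \<subseteq> ?S \<and> length P = n}"
    by (fastforce simp: families_def in_set_conv_nth)
  show "finite {P. set P \<subseteq> ?S \<and> length P = n}"
    by (rule finite_lists_length_eq) (simp add: finite_walks)
qed

lemma walk_end: "walk a b p \<Longrightarrow> b \<in> set p"
  by (auto simp: walk_def)

lemma families_neg:
  assumes "j < n" "e j < 0"
  shows "families n t e = {}"
proof (rule equals0I)
  fix P assume "P \<in> families n t e"
  then have "walk (0, 2 * int j) (int t, e j) (P ! j)" using assms by (simp add: families_def)
  with walk_end[OF this] assms(2) show False by (auto simp: walk_def)
qed

lemma families_eq:
  assumes "i < n" "j < n" "i \<noteq> j" "e i = e j"
  shows "families n t e = {}"
proof (rule equals0I)
  fix P assume P: "P \<in> families n t e"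
  have "(int t, e k) \<in> set (P ! k)" if "k < n" for k
    using P that by (auto simp: families_def intro: walk_end)
  then have "(int t, e i) \<in> set (P ! i)" "(int t, e i) \<in> set (P ! j)"
    using assms by metis+
  then show False using P assms by (auto simp: families_def vicious_def)
qed

lemma walk_snoc:
  "walk a b (p @ [q]) \<longleftrightarrow> q = b \<and> 0 \<le> snd b \<and>
     (if p = [] then a = b else walk a (last p) p \<and> walk_step (last p) b)"
  by (auto simp: walk_def successively_append_iff)

lemma walk_Suc:
  "walk (0, a) (int (Suc t), b) w \<longleftrightarrow> 0 \<le> b \<and> (\<exists>p c. w = p @ [(int (Suc t), b)] \<and> walk (0, a) (int t, c) p \<and> \<bar>b - c\<bar> = 1)"
    (is "?L \<longleftrightarrow> ?R")
proof
  assume L: ?L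
  then have "w \<noteq> []" by (simp add: walk_def)
  then obtain p q where w: "w = p @ [q]" by (metis rev_exhaust)
  show ?R
    using L unfolding w walk_snoc
    by (cases "p = []"; cases "last p") (auto simp: walk_step_def)
next
  assume ?R
  then show ?L by (auto simp: walk_def successively_append_iff walk_step_def)
qed

definition extend :: "nat \<Rightarrow> (nat \<Rightarrow> int) \<Rightarrow> point list list \<Rightarrow> point list list" where
  "extend t e P = map (\<lambda>i. P ! i @ [(int (Suc t), e i)]) [0..<length P]"

lemma length_extend [simp]: "length (extend t e P) = length P"
  by (simp add: extend_def)

lemma nth_extend [simp]: "i < length P \<Longrightarrow> extend t e P ! i = P ! i @ [(int (Suc t), e i)]"
  by (simp add: extend_def)

text \<open>Separates the points appended at time \<open>Suc t\<close> from all earlier ones, both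
  for viciousness and for the count of contacts.\<close>

lemma families_time_bound:
  assumes "P \<in> families n t e" "i < n" "q \<in> set (P ! i)"
  shows "fst q \<le> int t"
proof -
  have "walk (0, 2 * int i) (int t, e i) (P ! i)" using assms by (simp add: families_def)
  then show ?thesis using walk_length_bounds(2)[of "P ! i" q] assms(3) by (auto simp: walk_def)
qed

lemma vicious_extend:
  assumes P: "P \<in> families n t e'" and e: "inj_on e {0..<n}"
  shows "vicious (extend t e P)"
proof -
  have len: "length P = n" and vic: "vicious P" using P by (auto simp: families_def)
  have "set (P ! i @ [(int (Suc t), e i)]) \<inter> set (P ! j @ [(int (Suc t), e j)]) = {}"
    if "i < n" "j < n" "i \<noteq> j" for i j
  proof -
    have "(int (Suc t), x) \<notin> set (P ! k)" if "k < n" for x k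
      using families_time_bound[OF P that] by force
    moreover have "e i \<noteq> e j" using that e by (auto dest: inj_onD)
    moreover have "set (P ! i) \<inter> set (P ! j) = {}" using that vic len by (simp add: vicious_def)
    ultimately show ?thesis using that by auto
  qed
  then show ?thesis by (simp add: vicious_def len)
qed

lemma contacts_extend:
  assumes P: "P \<in> families n t e'" and e: "inj_on e {0..<n}"
  shows "contacts (extend t e P) = contacts P + card {j \<in> {0..<n}. e j = 0}"
proof -
  have len: "length P = n" using P by (auto simp: families_def)
  let ?A = "{q. snd q = 0 \<and> (\<exists>p\<in>set P. q \<in> set p)}"
  let ?B = "(\<lambda>j. (int (Suc t), e j)) ` {j \<in> {0..<n}. e j = 0}"
  have "{q. snd q = 0 \<and> (\<exists>p\<in>set (extend t e P). q \<in> set p)} = ?A \<union> ?B"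
    by (force simp: in_set_conv_nth[of _ P] len extend_def)
  moreover have "finite ?A"
    by (rule finite_subset[of _ "\<Union>p\<in>set P. set p"]) auto
  moreover have "?A \<inter> ?B = {}"
    using families_time_bound[OF P] by (force simp: in_set_conv_nth[of _ P] len)
  moreover have "card ?B = card {j \<in> {0..<n}. e j = 0}"
    by (rule card_image) (use e in \<open>auto simp: inj_on_def\<close>)
  ultimately show ?thesis
    unfolding contacts_def by (simp add: card_Un_disjoint)
qed

lemma wsum_Suc:
  assumes e: "inj_on e {0..<n}" and nonneg: "\<And>j. j < n \<Longrightarrow> 0 \<le> e j"
  shows "wsum \<kappa> n (Suc t) e = \<kappa> ^ card {j \<in> {0..<n}. e j = 0} *
           (\<Sum>e'\<in>PiE {0..<n} (\<lambda>j. {e j - 1, e j + 1}). wsum \<kappa> n t e')"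
proof -
  let ?E = "PiE {0..<n} (\<lambda>j. {e j - 1, e j + 1})"
  have "(\<Sum>(e', P)\<in>(SIGMA e':?E. families n t e'). \<kappa> ^ card {j \<in> {0..<n}. e j = 0} * \<kappa> ^ contacts P)
      = wsum \<kappa> n (Suc t) e"
    unfolding wsum_def
  \<comment> \<open>The inverse drops the last point of each walk and reads \<open>e'\<close> off
    the penultimate heights; the restriction to \<open>{0..<n}\<close> makes this function a member
    of \<open>PiE\<close>. Choices \<open>e'\<close> that admit no family contribute
    nothing.\<close>
  proof (rule sum.reindex_bij_witness[where j = "\<lambda>(e', P). extend t e P"
        and i = "\<lambda>Q. (\<lambda>j\<in>{0..<n}. snd (last (butlast (Q ! j))), map butlast Q)"], goal_cases)
    case (1 x)
    then obtain e' P where x: "x = (e', P)" "e' \<in> ?E" and P: "P \<in> families n t e'" by auto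
    have len: "length P = n" using P by (simp add: families_def)
    have "snd (last (P ! j)) = e' j" if "j < n" for j
      using P that by (simp add: families_def walk_def)
    then have "(\<lambda>j\<in>{0..<n}. snd (last (butlast (extend t e P ! j)))) = e'"
      using x(2) by (intro ext) (auto simp: len PiE_def extensional_def)
    moreover have "map butlast (extend t e P) = P"
      by (rule nth_equalityI) (auto simp: len)
    ultimately show ?case by (simp add: x)
  next
    case (2 x)
    then obtain e' P where x: "x = (e', P)" "e' \<in> ?E" and P: "P \<in> families n t e'" by auto
    have len: "length P = n" using P by (simp add: families_def)
    have "walk (0, 2 * int i) (int (Suc t), e i) (extend t e P ! i)" if i: "i < n" for i
    proof -
      have "walk (0, 2 * int i) (int t, e' i) (P ! i)" using P i by (simp add: families_def)
      moreover have "\<bar>e i - e' i\<bar> = 1" using x(2) i by (force simp: PiE_def Pi_def)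
      ultimately show ?thesis
        unfolding walk_Suc using nonneg[OF i] i len by auto
    qed
    then show ?case
      using vicious_extend[OF P e] by (simp add: x families_def len)
  next
    case (3 Q)
    then have Q: "length Q = n" "vicious Q"
      "\<And>i. i < n \<Longrightarrow> walk (0, 2 * int i) (int (Suc t), e i) (Q ! i)"
      by (auto simp: families_def)
    show ?case
    proof (simp, rule nth_equalityI)
      fix i assume "i < length (extend t e (map butlast Q))"
      then have "i < n" by (simp add: Q)
      then show "extend t e (map butlast Q) ! i = Q ! i"
        using Q(3)[of i] unfolding walk_Suc by (auto simp: Q)
    qed simp
  next
    case (4 Q)
    then have Q: "length Q = n" "vicious Q"
      "\<And>i. i < n \<Longrightarrow> walk (0, 2 * int i) (int (Suc t), e i) (Q ! i)"
      by (auto simp: families_def)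
    let ?e' = "\<lambda>j\<in>{0..<n}. snd (last (butlast (Q ! j)))"
    have *: "walk (0, 2 * int i) (int t, ?e' i) (butlast (Q ! i)) \<and> ?e' i \<in> {e i - 1, e i + 1}" if i: "i < n" for i
    proof -
      obtain p c where p: "Q ! i = p @ [(int (Suc t), e i)]" "walk (0, 2 * int i) (int t, c) p" "\<bar>e i - c\<bar> = 1"
        using Q(3)[OF i] unfolding walk_Suc by blast
      then have "last p = (int t, c)" by (simp add: walk_def)
      then show ?thesis using p i by auto
    qed
    have "vicious (map butlast Q)"
      using Q(1,2) by (fastforce simp: vicious_def dest: in_set_butlastD)
    then show ?case
      using * by (auto simp: families_def Q)
  next
    case (5 x)
    then show ?case
      using contacts_extend[OF _ e] by (auto simp: power_add)
  qed
  then show ?thesis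
    by (simp add: sum.Sigma[symmetric] finite_families finite_PiE wsum_def sum_distrib_left)
qed

text \<open>Distinct heights of equal parity are at least 2 apart. This yields both the minimal end
  heights at time 0 and the impossibility of crossing in a single step.\<close>

lemma even_chain_gap:
  fixes e :: "nat \<Rightarrow> int"
  assumes mono: "\<And>i j. i < j \<Longrightarrow> j < n \<Longrightarrow> e i < e j" and parity: "\<And>j. j < n \<Longrightarrow> even (e j - c)"
    and "i \<le> j" "j < n"
  shows "e i + 2 * int (j - i) \<le> e j"
  using assms(3,4)
proof (induction j rule: dec_induct)
  case (step j)
  have "e j < e (Suc j)" "even (e (Suc j) - e j)"
    using mono[of j "Suc j"] parity[of j] parity[of "Suc j"] step.prems by auto
  then have "e j + 2 \<le> e (Suc j)" by presburger
  then show ?case using step by (simp add: Suc_diff_le)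
qed simp

text \<open>The source of \<open>\<kappa> ^ n\<close>. For the heights \<open>2 * j\<close> the
  matrix is triangular with \<open>Suc n\<close> diagonal entries \<open>\<kappa>\<close>, whereas
  the single family of one-point walks has only the contact \<open>(0, 0)\<close>. All other heights
  give 0 on both sides.\<close>

lemma wsum_0:
  assumes mono: "\<And>i j. i < j \<Longrightarrow> j < Suc n \<Longrightarrow> e i < e j"
    and nonneg: "\<And>j. j < Suc n \<Longrightarrow> 0 \<le> e j"
    and parity: "\<And>j. j < Suc n \<Longrightarrow> even (e j)"
  shows "wsum \<kappa> (Suc n) 0 e * \<kappa> ^ n = wdet \<kappa> (Suc n) 0 e"
proof (cases "\<forall>j<Suc n. e j = 2 * int j")
  case True
  have "families (Suc n) 0 e = {map (\<lambda>i. [(0, 2 * int i)]) [0..<Suc n]}" (is "_ = {?P}")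
  proof (intro equalityI subsetI)
    fix P assume P: "P \<in> families (Suc n) 0 e"
    have "P ! i = [(0, 2 * int i)]" if i: "i < Suc n" for i
    proof -
      have w: "walk (0, 2 * int i) (0, 2 * int i) (P ! i)"
        using P i True by (simp add: families_def)
      then have "length (P ! i) = 1"
        using walk_length_bounds(1)[of "P ! i"] by (simp add: walk_def)
      then show ?thesis using w by (auto simp: length_Suc_conv walk_def)
    qed
    moreover have "length P = Suc n" using P by (simp add: families_def)
    ultimately show "P \<in> {?P}" by (auto intro!: nth_equalityI simp del: upt_Suc)
  next
    fix P assume "P \<in> {?P}"
    then show "P \<in> families (Suc n) 0 e"
      using True by (auto simp: families_def vicious_def walk_def simp del: upt_Suc)
  qed
  moreover have "{q. snd q = 0 \<and> (\<exists>p\<in>set ?P. q \<in> set p)} = {(0, 0)}"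
    by (force simp del: upt_Suc)
  then have "contacts ?P = 1" by (simp add: contacts_def del: upt_Suc)
  ultimately have "wsum \<kappa> (Suc n) 0 e = \<kappa>" by (simp add: wsum_def del: upt_Suc)
  moreover have "wdet \<kappa> (Suc n) 0 e = \<kappa> ^ Suc n"
  proof -
    let ?M = "mat (Suc n) (Suc n) (\<lambda>(j, i). wcount \<kappa> (0 + 2 * i) (e j))"
    have "wdet \<kappa> (Suc n) 0 e = prod_list (diag_mat ?M)"
      unfolding wdet_def
      by (rule det_upper_triangular[of _ "Suc n"]) (use True in \<open>auto simp: upper_triangular_def intro!: wcount_above\<close>)
    also have "diag_mat ?M = replicate (Suc n) \<kappa>"
      using True wcount_top[of \<kappa> "2 * _"] by (auto simp: diag_mat_def intro!: nth_equalityI simp del: upt_Suc replicate_Suc)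
    finally show ?thesis by (simp add: prod_list_replicate)
  qed
  ultimately show ?thesis by simp
next
  case False
  then obtain j where j: "j < Suc n" "e j \<noteq> 2 * int j" by blast
  have "2 * int j \<le> e j"
    using even_chain_gap[of "Suc n" e 0 0 j] mono parity nonneg[of 0] j by simp
  then have "2 * int j + 2 \<le> e j" using j parity[of j] by presburger
  \<comment> \<open>A deviation at \<open>j\<close> propagates upwards through the gaps of at least
    2, so the top height exceeds the largest length \<open>2 * n\<close> and row \<open>n\<close> is
    zero.\<close>
  then have *: "2 * int n < e n"
    using even_chain_gap[of "Suc n" e 0 j n] mono parity j by simp
  have "wdet \<kappa> (Suc n) 0 e = 0"
    unfolding wdet_leibniz
  proof (intro sum.neutral ballI)
    fix p assume "p \<in> {p. p permutes {0..<Suc n}}"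
    then have "p n < Suc n" using permutes_in_image[of p "{0..<Suc n}" n] by simp
    then have "wcount \<kappa> (0 + 2 * p n) (e n) = 0" using * by (intro wcount_above) simp
    then show "signof p * (\<Prod>j\<in>{0..<Suc n}. wcount \<kappa> (0 + 2 * p j) (e j)) = 0" by simp
  qed
  moreover have "families (Suc n) 0 e = {}"
  proof (rule equals0I)
    fix P assume "P \<in> families (Suc n) 0 e"
    then have w: "walk (0, 2 * int j) (0, e j) (P ! j)" using j by (simp add: families_def)
    then have "length (P ! j) = 1"
      using walk_length_bounds(1)[of "P ! j"] by (simp add: walk_def)
    then show False using w j by (auto simp: length_Suc_conv walk_def)
  qed
  ultimately show ?thesis by (simp add: wsum_def)
qed

text \<open>Induction on \<open>t\<close> through the common recursion. A choice of predecessors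
  with a negative or repeated height contributes 0 to both sides; any other is still strictly
  increasing, because the heights in \<open>e\<close> were at least 2 apart, so the induction
  hypothesis applies.\<close>

lemma wsum_eq_wdet:
  assumes "\<And>i j. i < j \<Longrightarrow> j < Suc n \<Longrightarrow> e i < e j"
    and "\<And>j. j < Suc n \<Longrightarrow> 0 \<le> e j"
    and "\<And>j. j < Suc n \<Longrightarrow> even (e j - int t)"
  shows "wsum \<kappa> (Suc n) t e * \<kappa> ^ n = wdet \<kappa> (Suc n) t e"
  using assms
proof (induction t arbitrary: e)
  case 0
  then show ?case by (intro wsum_0) auto
next
  case (Suc t)
  have inj: "inj_on e {0..<Suc n}"
    using Suc.prems(1) by (intro linorder_inj_onI) force+
  have step: "wsum \<kappa> (Suc n) t e' * \<kappa> ^ n = wdet \<kappa> (Suc n) t e'"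
    if e': "e' \<in> PiE {0..<Suc n} (\<lambda>j. {e j - 1, e j + 1})" for e'
  proof -
    have near: "e' j = e j - 1 \<or> e' j = e j + 1" if "j < Suc n" for j
      using e' that by (auto simp: PiE_def Pi_def)
    consider j where "j < Suc n" "e' j < 0" | i j where "i < Suc n" "j < Suc n" "i \<noteq> j" "e' i = e' j"
      | "\<forall>j<Suc n. 0 \<le> e' j" "\<forall>i<Suc n. \<forall>j<Suc n. i \<noteq> j \<longrightarrow> e' i \<noteq> e' j"
      by (meson not_less)
    then show ?thesis
    proof cases
      case 1
      then show ?thesis by (simp add: wdet_neg families_neg wsum_def)
    next
      case 2
      then show ?thesis by (simp add: wdet_eq[of i _ j] families_eq[of i _ j] wsum_def)
    next
      case 3
      show ?thesis
      proof (rule Suc.IH)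
        fix i j assume ij: "i < j" "j < Suc n"
        have "e i + 2 * int (j - i) \<le> e j"
          using ij Suc.prems by (intro even_chain_gap[of "Suc n" _ "int (Suc t)"]) auto
        then have "e i + 2 \<le> e j" using ij by simp
        moreover have "e' i \<noteq> e' j" "e' i = e i - 1 \<or> e' i = e i + 1" "e' j = e j - 1 \<or> e' j = e j + 1"
          using 3(2) ij near[of i] near[of j] by simp_all
        ultimately show "e' i < e' j" by presburger
      next
        fix j assume "j < Suc n"
        then have "0 \<le> e' j" "e' j = e j - 1 \<or> e' j = e j + 1" "even (e j - int (Suc t))"
          using 3(1) near[of j] Suc.prems(3)[of j] by simp_all
        then show "0 \<le> e' j" "even (e' j - int t)"
          by simp_all presburger
      qed
    qed
  qed
  have "(\<Prod>j\<in>{0..<Suc n}. if e j = 0 then \<kappa> else 1) = \<kappa> ^ card {j \<in> {0..<Suc n}. e j = 0}"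
    by (simp only: prod.If_cases finite_atLeastLessThan) (simp add: Int_def)
  moreover have "wsum \<kappa> (Suc n) (Suc t) e = \<kappa> ^ card {j \<in> {0..<Suc n}. e j = 0} *
      (\<Sum>e'\<in>PiE {0..<Suc n} (\<lambda>j. {e j - 1, e j + 1}). wsum \<kappa> (Suc n) t e')"
    using Suc.prems(2) by (intro wsum_Suc inj)
  moreover have "wdet \<kappa> (Suc n) (Suc t) e = (\<Prod>j\<in>{0..<Suc n}. if e j = 0 then \<kappa> else 1) *
      (\<Sum>e'\<in>PiE {0..<Suc n} (\<lambda>j. {e j - 1, e j + 1}). wdet \<kappa> (Suc n) t e')"
    using Suc.prems(2) by (intro wdet_Suc)
  ultimately show ?case
    by (simp add: step sum_distrib_right mult.assoc)
qed

section \<open>Factorial forms of Pochhammer symbols and the specialised Whipple identity\<close>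

lemma pochhammer_of_nat_Suc: "pochhammer (of_nat m + 1) k = (fact (m + k) / fact m :: 'a::field_char_0)"
  by (induction k) (simp_all add: pochhammer_Suc algebra_simps)

lemma pochhammer_falling:
  "pochhammer (of_nat p - of_nat q + 1) q = ((if q \<le> p then fact p / fact (p - q) else 0) :: 'a::field_char_0)"
proof (cases "q \<le> p")
  case True
  then show ?thesis
    using pochhammer_of_nat_Suc[of "p - q" q, where ?'a = 'a] by simp
next
  case False
  then obtain r where q: "q = Suc (p + r)" using less_imp_Suc_add[of p q] by auto
  then have "of_nat p - of_nat q + 1 = (- of_nat r :: 'a)" by simp
  then show ?thesis using False
    by (simp add: pochhammer_of_nat_eq_0_lemma q)
qed

lemma pochhammer_minus_of_nat:
  assumes "k \<le> m"
  shows "pochhammer (- of_nat m) k = ((-1) ^ k * fact m / fact (m - k) :: 'a::field_char_0)"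
  using assms by (simp add: pochhammer_minus pochhammer_falling)

text \<open>Whipple's transformation with parameters \<open>(t - l) / 2\<close>, \<open>(t - l + 1) / 2\<close>, \<open>d + 1 - N - l\<close> and
  \<open>(y - 1) / 2\<close>, \<open>y / 2\<close>, \<open>- d - N\<close>; the factor \<open>4 ^ N\<close> merges the half-integer pairs.\<close>

lemma whipple_special:
  fixes N y d l t :: nat
  assumes t: "t = y + 2 * d" "t > 0" and l: "l \<le> d"
  shows "(\<Sum>i\<le>N. (-1) ^ i * of_nat (N choose i)
      * (if N + l \<le> d + i then fact (d + i) / fact (d + i - N - l) else 0)
      * (fact (t + 2 * i - l - 1) / fact (t + 2 * i))) * (fact (t + 2 * N) / fact (t - l - 1))
    = (\<Sum>k\<le>N. (-1) ^ (N - k) * of_nat (N choose k) * pochhammer (of_nat y - 1) (2 * k)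
      * pochhammer (of_nat (y + l + 2 * k)) (2 * N - 2 * k)
      * (if k + l \<le> d then fact (d + N - k) / fact (d - l - k) else 0) :: 'a::field_char_0)"
    (is "?L = ?R")
proof -
  define a b c d' e' f :: 'a where
    "a = of_nat (t - l) / 2" and "b = a + 1/2" and "c = of_nat d + 1 - of_nat N - of_nat l"
    and "d' = (of_nat y - 1) / 2" and "e' = d' + 1/2" and "f = - of_nat d - of_nat N"
  have tl: "l < t" using t l by linarith
  have double: "4 ^ m * (pochhammer z m * pochhammer (z + 1/2) m) = pochhammer (2 * z) (2 * m)" for z :: 'a and m
    by (simp add: pochhammer_double power_mult)
  have balanced: "c - a - b = f - d' - e'"
    using tl by (simp add: a_def b_def c_def d'_def e'_def f_def t(1) of_nat_diff field_simps)
  have W: "whipple_sum N a b c d' e' f = whipple_sum N d' e' f a b c"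
    using balanced by (rule whipple)
  \<comment> \<open>The factor common to both sides: in each expansion fact \<open>3\<close>
    supplies the numerator and fact \<open>4\<close> the denominator. It is nonzero and is cancelled
    at the end.\<close>
  define C :: 'a where "C = fact (d - l) / fact d"
  have "4 ^ N * whipple_sum N a b c d' e' f = C * ?L"
    unfolding whipple_sum_def sum_distrib_left sum_distrib_right
  proof (intro sum.cong refl)
    fix i assume "i \<in> {..N}"
    then have i: "i \<le> N" by simp
    have 1: "4 ^ i * (pochhammer a i * pochhammer b i) = fact (t + 2 * i - l - 1) / fact (t - l - 1)"
    proof -
      have "2 * a = of_nat (t - l - 1) + 1" using tl by (simp add: a_def of_nat_diff)
      then have "pochhammer (2 * a) (2 * i) = fact (t - l - 1 + 2 * i) / fact (t - l - 1)"
        by (simp add: pochhammer_of_nat_Suc)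
      moreover have "t - l - 1 + 2 * i = t + 2 * i - l - 1" using tl by simp
      ultimately show ?thesis unfolding b_def double by simp
    qed
    have 2: "4 ^ (N - i) * (pochhammer (f - d') (N - i) * pochhammer (f - e') (N - i)) = fact (t + 2 * N) / fact (t + 2 * i)"
    proof -
      have "f - d' = (f - e') + 1/2" by (simp add: e'_def)
      moreover have "2 * (f - e') = - of_nat (t + 2 * N)"
        by (simp add: f_def e'_def d'_def t(1) field_simps)
      ultimately have "4 ^ (N - i) * (pochhammer (f - d') (N - i) * pochhammer (f - e') (N - i)) =
          pochhammer (- of_nat (t + 2 * N)) (2 * (N - i))"
        using double[of "N - i" "f - e'"] by (simp only: mult.commute)
      also have "\<dots> = fact (t + 2 * N) / fact (t + 2 * N - 2 * (N - i))"
        by (subst pochhammer_minus_of_nat) auto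
      also have "t + 2 * N - 2 * (N - i) = t + 2 * i" using i by simp
      finally show ?thesis .
    qed
    have 3: "pochhammer (c + of_nat i) (N - i) = (if N + l \<le> d + i then fact (d - l) / fact (d + i - N - l) else 0)"
    proof -
      have "c + of_nat i = of_nat (d - l) - of_nat (N - i) + 1"
        using i l by (simp add: c_def of_nat_diff)
      moreover have "N - i \<le> d - l \<longleftrightarrow> N + l \<le> d + i" "d - l - (N - i) = d + i - N - l" using i l by auto
      ultimately show ?thesis by (simp only: pochhammer_falling)
    qed
    have 4: "pochhammer (f + of_nat (N - i)) i = (-1) ^ i * fact (d + i) / fact d"
    proof -
      have "f + of_nat (N - i) = - of_nat (d + i)" using i by (simp add: f_def of_nat_diff)
      then show ?thesis by (simp only: pochhammer_minus_of_nat) (simp add: pochhammer_minus_of_nat del: of_nat_add)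
    qed
    have "4 ^ N = (4 ^ i * 4 ^ (N - i) :: 'a)" using i by (simp flip: power_add)
    then have "4 ^ N * (of_nat (N choose i) *
          (pochhammer a i * pochhammer b i * pochhammer (c + of_nat i) (N - i) *
           (pochhammer (f - d') (N - i) * pochhammer (f - e') (N - i)) * pochhammer (f + of_nat (N - i)) i))
        = of_nat (N choose i) * (4 ^ i * (pochhammer a i * pochhammer b i)) * pochhammer (c + of_nat i) (N - i)
          * (4 ^ (N - i) * (pochhammer (f - d') (N - i) * pochhammer (f - e') (N - i))) * pochhammer (f + of_nat (N - i)) i"
      by (simp only: mult_ac)
    also have "\<dots> = C * ((-1) ^ i * of_nat (N choose i)
      * (if N + l \<le> d + i then fact (d + i) / fact (d + i - N - l) else 0)
      * (fact (t + 2 * i - l - 1) / fact (t + 2 * i)) * (fact (t + 2 * N) / fact (t - l - 1)))"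
      unfolding 1 2 3 4 C_def by (simp add: mult_ac)
    finally show "4 ^ N * (of_nat (N choose i) *
          (pochhammer a i * pochhammer b i * pochhammer (c + of_nat i) (N - i) *
           (pochhammer (f - d') (N - i) * pochhammer (f - e') (N - i)) * pochhammer (f + of_nat (N - i)) i)) = \<dots>" .
  qed
  moreover have "4 ^ N * whipple_sum N d' e' f a b c = C * ?R"
    unfolding whipple_sum_def sum_distrib_left
  proof (intro sum.cong refl)
    fix k assume "k \<in> {..N}"
    then have k: "k \<le> N" by simp
    have 1: "4 ^ k * (pochhammer d' k * pochhammer e' k) = pochhammer (of_nat y - 1) (2 * k)"
    proof -
      have "2 * d' = of_nat y - 1" by (simp add: d'_def field_simps)
      then show ?thesis unfolding e'_def double by simp
    qed
    have 2: "4 ^ (N - k) * (pochhammer (c - a) (N - k) * pochhammer (c - b) (N - k)) = pochhammer (of_nat (y + l + 2 * k)) (2 * N - 2 * k)"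
    proof -
      have "c - a = (c - b) + 1/2" by (simp add: b_def)
      moreover have "2 * (c - b) = - (of_nat (y + 2 * N + l) - 1)"
        using tl by (simp add: a_def b_def c_def t(1) of_nat_diff field_simps)
      ultimately have "4 ^ (N - k) * (pochhammer (c - a) (N - k) * pochhammer (c - b) (N - k)) =
          pochhammer (- (of_nat (y + 2 * N + l) - 1)) (2 * (N - k))"
        using double[of "N - k" "c - b"] by (simp only: mult.commute)
      also have "\<dots> = pochhammer (of_nat (y + 2 * N + l) - 1 - of_nat (2 * (N - k)) + 1) (2 * (N - k))"
        unfolding pochhammer_minus by simp
      also have "of_nat (y + 2 * N + l) - 1 - of_nat (2 * (N - k)) + 1 = (of_nat (y + l + 2 * k) :: 'a)"
        using k by (simp add: of_nat_diff algebra_simps)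
      finally show ?thesis by (simp add: diff_mult_distrib2)
    qed
    have 3: "pochhammer (c + of_nat (N - k)) k = (if k + l \<le> d then fact (d - l) / fact (d - l - k) else 0)"
    proof -
      have "c + of_nat (N - k) = of_nat (d - l) - of_nat k + 1"
        using k l by (simp add: c_def of_nat_diff)
      moreover have "k \<le> d - l \<longleftrightarrow> k + l \<le> d" using l by auto
      ultimately show ?thesis by (simp only: pochhammer_falling)
    qed
    have 4: "pochhammer (f + of_nat k) (N - k) = (-1) ^ (N - k) * fact (d + N - k) / fact d"
    proof -
      have "f + of_nat k = - of_nat (d + N - k)" "d + N - k - (N - k) = d"
        using k by (simp_all add: f_def of_nat_diff)
      then show ?thesis using k by (simp add: pochhammer_minus_of_nat del: of_nat_diff)
    qed
    have "4 ^ N = (4 ^ k * 4 ^ (N - k) :: 'a)" using k by (simp flip: power_add)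
    then have "4 ^ N * (of_nat (N choose k) *
          (pochhammer d' k * pochhammer e' k * pochhammer (f + of_nat k) (N - k) *
           (pochhammer (c - a) (N - k) * pochhammer (c - b) (N - k)) * pochhammer (c + of_nat (N - k)) k))
        = of_nat (N choose k) * (4 ^ k * (pochhammer d' k * pochhammer e' k)) * pochhammer (f + of_nat k) (N - k)
          * (4 ^ (N - k) * (pochhammer (c - a) (N - k) * pochhammer (c - b) (N - k))) * pochhammer (c + of_nat (N - k)) k"
      by (simp only: mult_ac)
    also have "\<dots> = C * ((-1) ^ (N - k) * of_nat (N choose k) * pochhammer (of_nat y - 1) (2 * k)
      * pochhammer (of_nat (y + l + 2 * k)) (2 * N - 2 * k)
      * (if k + l \<le> d then fact (d + N - k) / fact (d - l - k) else 0))"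
      unfolding 1 2 3 4 C_def by simp
    finally show "4 ^ N * (of_nat (N choose k) *
          (pochhammer d' k * pochhammer e' k * pochhammer (f + of_nat k) (N - k) *
           (pochhammer (c - a) (N - k) * pochhammer (c - b) (N - k)) * pochhammer (c + of_nat (N - k)) k)) = \<dots>" .
  qed
  moreover have "C \<noteq> 0" by (simp add: C_def)
  ultimately have "C \<noteq> 0" "C * ?L = C * ?R" using W by metis+
  then show ?thesis by (rule iffD1[OF mult_left_cancel])
qed

section \<open>Column and row operations on the determinant\<close>

text \<open>Multiplication by \<open>U\<close>, the identity with last column \<open>u\<close>,
  replaces the last column by the weighted sum of all columns. Only its bottom entry survives, and
  Laplace expansion leaves the leading minor.\<close>

lemma det_last_column:
  fixes f :: "nat \<Rightarrow> nat \<Rightarrow> 'a::comm_ring_1"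
  assumes "\<And>j. j < N \<Longrightarrow> (\<Sum>i\<le>N. f j i * u i) = 0"
  shows "det (mat (Suc N) (Suc N) (\<lambda>(j, i). f j i)) * u N
       = (\<Sum>i\<le>N. f N i * u i) * det (mat N N (\<lambda>(j, i). f j i))"
proof -
  let ?M = "mat (Suc N) (Suc N) (\<lambda>(j, i). f j i)"
  define U where "U = mat (Suc N) (Suc N) (\<lambda>(i, k). if k = N then u i else if i = k then 1 else 0)"
  have carrier: "?M \<in> carrier_mat (Suc N) (Suc N)" "U \<in> carrier_mat (Suc N) (Suc N)"
    by (simp_all add: U_def)
  have "det U = prod_list (diag_mat U)"
    using carrier by (intro det_upper_triangular[of _ "Suc N"]) (auto simp: U_def upper_triangular_def)
  also have "\<dots> = (\<Prod>i<Suc N. if i = N then u i else 1)"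
    unfolding prod_list_diag_prod atLeast0LessThan by (rule prod.cong) (auto simp: U_def)
  also have "\<dots> = u N" by simp
  finally have U: "det U = u N" .
  have dim: "dim_col U = Suc N" by (simp add: U_def)
  have entry: "(?M * U) $$ (j, k) = (if k = N then \<Sum>i\<le>N. f j i * u i else f j k)"
    if "j < Suc N" "k < Suc N" for j k
  proof -
    have "(?M * U) $$ (j, k) = (\<Sum>i<Suc N. f j i * (if k = N then u i else if i = k then 1 else 0))"
      using that by (auto simp: U_def scalar_prod_def atLeast0LessThan simp del: sum.lessThan_Suc intro!: sum.cong)
    also have "\<dots> = (if k = N then \<Sum>i\<le>N. f j i * u i else f j k)"
      using that by (cases "k = N") (auto simp: lessThan_Suc_atMost if_distrib[of "\<lambda>x. _ * x"] cong: if_cong)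
    finally show ?thesis .
  qed
  have MU: "?M * U \<in> carrier_mat (Suc N) (Suc N)" by (rule mult_carrier_mat[OF carrier])
  have "det (?M * U) = (\<Sum>j<Suc N. (?M * U) $$ (j, N) * cofactor (?M * U) j N)"
    by (rule laplace_expansion_column[OF MU]) simp
  also have "\<dots> = (?M * U) $$ (N, N) * cofactor (?M * U) N N"
    using assms by (simp add: entry)
  also have "cofactor (?M * U) N N = det (mat N N (\<lambda>(j, i). f j i))"
  proof -
    have "mat_delete (?M * U) N N = mat N N (\<lambda>(j, i). f j i)"
      by (intro eq_matI) (auto simp: mat_delete_def entry dim simp del: index_mult_mat(1))
    then show ?thesis by (simp add: cofactor_def)
  qed
  finally show ?thesis
    using det_mult[OF carrier] by (simp add: entry U)
qed

text \<open>The unitriangular \<open>A\<close> adds \<open>1 - \<kappa>\<close> times the next row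
  to each row, which is \<open>wcount_elim\<close> because adjacent end heights differ by 2. The
  last row has no successor and keeps its \<open>\<kappa>\<close>; the diagonal \<open>K\<close>
  collects the \<open>N\<close> factors extracted.\<close>

lemma wdet_elim:
  "wdet \<kappa> (Suc N) t (\<lambda>j. int y + 2 * int j) = \<kappa> ^ N * det (mat (Suc N) (Suc N)
     (\<lambda>(j, i). if j < N then wcount 1 (t + 2 * i) (int y + 2 * int j) else wcount \<kappa> (t + 2 * i) (int y + 2 * int j)))"
    (is "_ = _ * det ?B")
proof -
  let ?M = "mat (Suc N) (Suc N) (\<lambda>(j, i). wcount \<kappa> (t + 2 * i) (int y + 2 * int j))"
  define A where "A = mat (Suc N) (Suc N) (\<lambda>(j, k). if k = j then 1 else if k = Suc j then 1 - \<kappa> else 0)"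
  define K where "K = mat (Suc N) (Suc N) (\<lambda>(j, k). if k = j then if j < N then \<kappa> else 1 else 0)"
  have carrier: "?M \<in> carrier_mat (Suc N) (Suc N)" "?B \<in> carrier_mat (Suc N) (Suc N)"
    "A \<in> carrier_mat (Suc N) (Suc N)" "K \<in> carrier_mat (Suc N) (Suc N)"
    by (simp_all add: A_def K_def)
  have "det A = prod_list (diag_mat A)"
    using carrier by (intro det_upper_triangular[of _ "Suc N"]) (auto simp: A_def upper_triangular_def)
  also have "\<dots> = 1"
    by (simp add: prod_list_diag_prod A_def)
  finally have A: "det A = 1" .
  have "det K = prod_list (diag_mat K)"
    using carrier by (intro det_upper_triangular[of _ "Suc N"]) (auto simp: K_def upper_triangular_def)
  also have "\<dots> = (\<Prod>i<Suc N. if i < N then \<kappa> else 1)"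
    unfolding prod_list_diag_prod atLeast0LessThan by (rule prod.cong) (auto simp: K_def)
  also have "\<dots> = \<kappa> ^ N" by simp
  finally have K: "det K = \<kappa> ^ N" .
  have "A * ?M = K * ?B"
  proof (rule eq_matI)
    fix j i assume "j < dim_row (K * ?B)" "i < dim_col (K * ?B)"
    then have ji: "j < Suc N" "i < Suc N" by (simp_all add: K_def)
    let ?w = "\<lambda>k. wcount \<kappa> (t + 2 * i) (int y + 2 * int k)"
    have "(A * ?M) $$ (j, i) = (\<Sum>k<Suc N. (if k = j then 1 else if k = Suc j then 1 - \<kappa> else 0) * ?w k)"
      using ji by (auto simp: A_def scalar_prod_def atLeast0LessThan simp del: sum.lessThan_Suc intro!: sum.cong)
    also have "\<dots> = (\<Sum>k<Suc N. (if k = j then ?w k else 0) + (if k = Suc j then (1 - \<kappa>) * ?w k else 0))"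
      by (intro sum.cong) auto
    also have "\<dots> = ?w j + (if j < N then (1 - \<kappa>) * ?w (Suc j) else 0)"
      using ji unfolding sum.distrib by (auto simp: less_Suc_eq)
    also have "\<dots> = (if j < N then \<kappa> * wcount 1 (t + 2 * i) (int y + 2 * int j) else ?w j)"
      using wcount_elim[of "int y + 2 * int j" \<kappa> "t + 2 * i"] by (simp add: algebra_simps)
    also have "\<dots> = (K * ?B) $$ (j, i)"
    proof -
      have "(K * ?B) $$ (j, i) = (\<Sum>k<Suc N. (if k = j then if j < N then \<kappa> else 1 else 0) * ?B $$ (k, i))"
        using ji by (auto simp: K_def scalar_prod_def atLeast0LessThan simp del: sum.lessThan_Suc intro!: sum.cong)
      also have "\<dots> = (\<Sum>k<Suc N. if k = j then (if j < N then \<kappa> else 1) * ?B $$ (k, i) else 0)"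
        by (intro sum.cong) auto
      finally show ?thesis using ji by (auto simp: less_Suc_eq)
    qed
    finally show "(A * ?M) $$ (j, i) = (K * ?B) $$ (j, i)" .
  qed (simp_all add: A_def K_def)
  then have "det A * det ?M = det K * det ?B"
    using det_mult[OF carrier(3,1)] det_mult[OF carrier(4,2)] by simp
  then show ?thesis by (simp add: A K wdet_def)
qed

section \<open>Evaluation of the determinant\<close>

text \<open>Up to sign and normalisation, these weights are \<open>N\<close>-th difference weights: the factorials
  turn the ballot numbers ending at \<open>y + 2 * j\<close> into polynomials of degree \<open>N - 1\<close> in \<open>i\<close>.\<close>

definition rowweight :: "nat \<Rightarrow> nat \<Rightarrow> nat \<Rightarrow> nat \<Rightarrow> 'a::field_char_0" where
  "rowweight N y d i = (-1) ^ i * of_nat (N choose i) * (fact (y + d + i + N) * fact (d + i) / fact (y + 2 * d + 2 * i))"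

lemma prod_lessThan_add:
  fixes g :: "nat \<Rightarrow> 'a::comm_monoid_mult"
  shows "(\<Prod>r<j + k. g r) = (\<Prod>r<j. g r) * (\<Prod>r<k. g (j + r))"
  by (induction k) (simp_all add: mult_ac)

lemma fact_quotient_prod:
  "(if j \<le> m then fact m / fact (m - j) else 0) = (\<Prod>r<j. of_nat m - of_nat r :: 'a::field_char_0)"
proof (induction j)
  case (Suc j)
  show ?case
  proof (cases "Suc j \<le> m")
    case True
    then have "fact (m - j) = (of_nat (m - j) * fact (m - Suc j) :: 'a)"
      by (metis Suc_diff_Suc Suc_le_lessD fact_Suc)
    with True Suc.IH show ?thesis by (simp add: of_nat_diff field_simps)
  next
    case False
    then show ?thesis using Suc.IH by (cases "j = m") auto
  qed
qed simp

lemma fact_add_prod: "(fact (m + k) / fact m :: 'a::field_char_0) = (\<Prod>r<k. of_nat m + 1 + of_nat r)"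
  by (simp add: pochhammer_of_nat_Suc[symmetric] pochhammer_prod atLeast0LessThan)

lemma ballot_closed_form_even:
  "wcount 1 (y + 2 * d + 2 * i) (int y + 2 * int j) =
     ((if j \<le> d + i then fact (y + 2 * d + 2 * i) * of_nat (Suc (y + 2 * j)) / (fact (d + i - j) * fact (Suc (y + d + i + j))) else 0)
      :: 'a::field_char_0)"
proof (cases "j \<le> d + i")
  case True
  then obtain h where "d + i = j + h" using le_Suc_ex by blast
  then have h: "y + 2 * d + 2 * i = 2 * h + (y + 2 * j)" "d + i - j = h" "y + d + i + j = h + (y + 2 * j)"
    by simp_all
  have "int y + 2 * int j = int (y + 2 * j)" by simp
  then show ?thesis unfolding h using True by (simp only: ballot_closed_form if_True)
next
  case False
  then show ?thesis by (simp add: wcount_above)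
qed

lemma rowweight_annihilates:
  assumes "j < N"
  shows "(\<Sum>i\<le>N. wcount 1 (y + 2 * d + 2 * i) (int y + 2 * int j) * rowweight N y d i) = (0 :: 'a::field_char_0)"
proof -
  obtain k where N: "N = j + Suc k" using assms less_imp_Suc_add[of j N] by auto
  \<comment> \<open>The constant terms of the \<open>N - 1\<close> linear factors in
    \<open>i\<close>: \<open>j\<close> come from \<open>fact (d + i) / fact (d + i - j)\<close>,
    which is 0 exactly when height \<open>y + 2 * j\<close> is out of reach, and
    \<open>k = N - 1 - j\<close> from
    \<open>fact (y + d + i + N) / fact (Suc (y + d + i + j))\<close>.\<close>
  define a :: "nat \<Rightarrow> 'a" where
    "a r = (if r < j then of_nat d - of_nat r else of_nat (y + d + j + 2) + of_nat (r - j))" for r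
  have "wcount 1 (y + 2 * d + 2 * i) (int y + 2 * int j) * rowweight N y d i
      = of_nat (Suc (y + 2 * j)) * ((-1) ^ i * of_nat (N choose i) * (\<Prod>r<j + k. of_nat i + a r))" for i
  proof -
    have "(\<Prod>r<j + k. of_nat i + a r) = (\<Prod>r<j. of_nat (d + i) - of_nat r) *
            (\<Prod>r<k. of_nat (Suc (y + d + i + j)) + 1 + of_nat r)"
      unfolding prod_lessThan_add by (simp add: a_def algebra_simps)
    also have "\<dots> = (if j \<le> d + i then fact (d + i) / fact (d + i - j) else 0) *
         (fact (Suc (y + d + i + j) + k) / fact (Suc (y + d + i + j)))"
      unfolding fact_quotient_prod fact_add_prod ..
    also have "Suc (y + d + i + j) + k = y + d + i + N" by (simp add: N)
    finally show ?thesis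
      unfolding ballot_closed_form_even rowweight_def by (simp del: of_nat_Suc fact_Suc)
  qed
  moreover have "(\<Sum>i\<le>N. (-1) ^ i * of_nat (N choose i) * (\<Prod>r<j + k. of_nat i + a r)) = 0"
    by (rule sum_alt_choose_poly) (simp add: N)
  ultimately show ?thesis by (simp flip: sum_distrib_left)
qed

text \<open>For \<open>j = N\<close> the second factorial quotient is no longer polynomial but
  \<open>1 / (of_nat i + \<alpha>)\<close> with \<open>\<alpha> = y + d + N + 1\<close>, while the
  first gives \<open>N\<close> linear factors; \<open>sum_alt_choose_quotient\<close> then evaluates
  the sum.\<close>

lemma rowweight_ballot_sum:
  "(\<Sum>i\<le>N. wcount 1 (y + 2 * d + 2 * i) (int y + 2 * int N) * rowweight N y d i)
    = ((-1) ^ N * fact N * fact (y + 2 * N + 1) * fact (y + d + N) / (fact (y + N) * fact (y + d + 2 * N + 1)) :: 'a::field_char_0)"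
proof -
  define \<alpha> :: 'a where "\<alpha> = of_nat (y + d + N) + 1"
  have "wcount 1 (y + 2 * d + 2 * i) (int y + 2 * int N) * rowweight N y d i
      = of_nat (Suc (y + 2 * N)) * ((-1) ^ i * of_nat (N choose i) * (\<Prod>r<N. of_nat i + (of_nat d - of_nat r)) / (of_nat i + \<alpha>))" for i
  proof -
    have "(\<Prod>r<N. of_nat i + (of_nat d - of_nat r)) = (if N \<le> d + i then fact (d + i) / fact (d + i - N) else 0 :: 'a)"
      unfolding fact_quotient_prod by (simp add: algebra_simps)
    moreover have "of_nat i + \<alpha> = of_nat (Suc (y + d + i + N))" by (simp add: \<alpha>_def)
    moreover have "fact (Suc (y + d + i + N)) = (of_nat (Suc (y + d + i + N)) * fact (y + d + i + N) :: 'a)"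
      by (rule fact_Suc)
    ultimately show ?thesis
      unfolding ballot_closed_form_even rowweight_def by (simp del: of_nat_Suc fact_Suc)
  qed
  then have "(\<Sum>i\<le>N. wcount 1 (y + 2 * d + 2 * i) (int y + 2 * int N) * rowweight N y d i)
     = of_nat (Suc (y + 2 * N)) * (\<Sum>i\<le>N. (-1) ^ i * of_nat (N choose i) * (\<Prod>r<N. of_nat i + (of_nat d - of_nat r)) / (of_nat i + \<alpha>))"
    by (simp only: sum_distrib_left)
  also have "(\<Sum>i\<le>N. (-1) ^ i * of_nat (N choose i) * (\<Prod>r<N. of_nat i + (of_nat d - of_nat r)) / (of_nat i + \<alpha>))
     = (\<Prod>r<N. of_nat d - of_nat r - \<alpha>) * fact N / pochhammer \<alpha> (Suc N)"
  proof (rule sum_alt_choose_quotient)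
    fix i
    have "of_nat i + \<alpha> = of_nat (Suc (y + d + i + N))" by (simp add: \<alpha>_def)
    then show "of_nat i + \<alpha> \<noteq> 0" using of_nat_neq_0 by metis
  qed simp
  also have "(\<Prod>r<N. of_nat d - of_nat r - \<alpha>) = (\<Prod>r<N. (-1) * (of_nat (y + N) + 1 + of_nat r))"
    by (intro prod.cong) (simp_all add: \<alpha>_def)
  also have "\<dots> = (-1) ^ N * (fact (y + N + N) / fact (y + N))"
    unfolding prod.distrib fact_add_prod by simp
  also have "pochhammer \<alpha> (Suc N) = fact (y + d + N + Suc N) / fact (y + d + N)"
    unfolding \<alpha>_def by (rule pochhammer_of_nat_Suc)
  also have "y + d + N + Suc N = y + d + 2 * N + 1" by simp
  also have "y + N + N = y + 2 * N" by simp
  also have "of_nat (Suc (y + 2 * N)) * ((-1) ^ N * (fact (y + 2 * N) / fact (y + N)) * fact N /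
       (fact (y + d + 2 * N + 1) / fact (y + d + N)))
     = ((-1) ^ N * fact N * (of_nat (Suc (y + 2 * N)) * fact (y + 2 * N)) * fact (y + d + N) /
         (fact (y + N) * fact (y + d + 2 * N + 1)) :: 'a)"
    by (simp del: fact_Suc of_nat_Suc)
  also have "of_nat (Suc (y + 2 * N)) * fact (y + 2 * N) = (fact (y + 2 * N + 1) :: 'a)"
    by simp
  finally show ?thesis .
qed

text \<open>The index window from \<open>N\<close> to \<open>2 * N - 1\<close> moves to the one from
  \<open>N + 1\<close> to \<open>2 * N + 1\<close>: it loses \<open>N\<close> and gains
  \<open>2 * N\<close> and \<open>2 * N + 1\<close>. \<open>ballot_det\<close> needs this since its
  factors depend on \<open>N\<close>.\<close>

lemma prod_shift_double:
  fixes g :: "nat \<Rightarrow> 'a::comm_monoid_mult"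
  shows "(\<Prod>i<Suc N. g (Suc N + i)) * g N = (\<Prod>i<N. g (N + i)) * g (2 * N) * g (2 * N + 1)"
proof -
  have "g N * (\<Prod>i<Suc N. g (Suc N + i)) = (\<Prod>i<Suc (Suc N). g (N + i))"
    by (subst (2) prod.lessThan_Suc_shift) simp
  also have "\<dots> = (\<Prod>i<N. g (N + i)) * g (2 * N) * g (2 * N + 1)"
    by (simp add: mult_2)
  finally show ?thesis by (simp add: mult.commute)
qed

text \<open>The weights annihilate all rows but the last, so the ratio of consecutive determinants
  is \<open>rowweight_ballot_sum\<close> divided by the last weight.\<close>

lemma ballot_det:
  "det (mat N N (\<lambda>(j, i). wcount 1 (y + 2 * d + 2 * i) (int y + 2 * int j))) =
     (\<Prod>i<N. fact (y + 2 * d + 2 * i) * fact i * fact (y + N + i)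
         / (fact (d + i) * fact (y + d + N + i) * fact (y + 2 * i)) :: 'a::field_char_0)"
proof (induction N)
  case (Suc N)
  let ?t = "y + 2 * d"
  define D where "D N = det (mat N N (\<lambda>(j, i). wcount (1::'a) (?t + 2 * i) (int y + 2 * int j)))" for N
  define G :: "nat \<Rightarrow> nat \<Rightarrow> 'a" where "G z N = (\<Prod>i<N. fact (z + (N + i)))" for z N
  have G: "G z (Suc N) * fact (z + N) = G z N * fact (z + 2 * N) * fact (z + 2 * N + 1)" for z
    using prod_shift_double[of "\<lambda>r. fact (z + r)" N] by (simp only: G_def add.assoc)
  have "D (Suc N) * rowweight N y d N
      = (\<Sum>i\<le>N. wcount 1 (?t + 2 * i) (int y + 2 * int N) * rowweight N y d i) * D N"
    unfolding D_def by (rule det_last_column[OF rowweight_annihilates])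
  then have "D (Suc N) * ((-1) ^ N * (fact (y + d + 2 * N) * fact (d + N) / fact (?t + 2 * N)))
     = (-1) ^ N * fact N * fact (y + 2 * N + 1) * fact (y + d + N) / (fact (y + N) * fact (y + d + 2 * N + 1)) * D N"
    unfolding rowweight_ballot_sum by (simp add: rowweight_def mult_2 add.assoc del: fact_Suc)
  then have D: "D (Suc N) = fact (?t + 2 * N) * fact N * fact (y + 2 * N + 1) * fact (y + d + N)
        / (fact (d + N) * fact (y + N) * fact (y + d + 2 * N) * fact (y + d + 2 * N + 1)) * D N"
    by (simp add: divide_simps mult_ac del: fact_Suc)
  \<comment> \<open>The claimed product is split into \<open>Q\<close>, whose factors do not depend
    on \<open>N\<close>, and the moving windows \<open>G\<close>.\<close>
  define Q :: "nat \<Rightarrow> 'a" where "Q N = (\<Prod>i<N. fact (?t + 2 * i) * fact i / (fact (d + i) * fact (y + 2 * i)))" for N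
  have split: "(\<Prod>i<N. fact (?t + 2 * i) * fact i * fact (y + N + i) / (fact (d + i) * fact (y + d + N + i) * fact (y + 2 * i)))
       = Q N * G y N / G (y + d) N" for N
    unfolding Q_def G_def prod.distrib[symmetric] prod_dividef[symmetric]
    by (intro prod.cong refl) (simp add: add_ac)
  have Gnz: "G z N \<noteq> 0" for z N by (simp add: G_def)
  have Gy: "G y (Suc N) = G y N * fact (y + 2 * N) * fact (y + 2 * N + 1) / fact (y + N)"
    using G[of y] by (simp add: field_simps del: fact_Suc)
  have Gs: "G (y + d) (Suc N) = G (y + d) N * fact (y + d + 2 * N) * fact (y + d + 2 * N + 1) / fact (y + d + N)"
    using G[of "y + d"] by (simp add: field_simps del: fact_Suc)
  have Q: "Q (Suc N) = Q N * (fact (?t + 2 * N) * fact N / (fact (d + N) * fact (y + 2 * N)))"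
    by (simp add: Q_def)
  have "D (Suc N) = Q (Suc N) * G y (Suc N) / G (y + d) (Suc N)"
    unfolding D Q Gy Gs using Suc.IH[folded D_def, unfolded split] Gnz[of "y + d" N]
    by (simp add: divide_simps mult_ac del: fact_Suc)
  then show ?case unfolding split D_def .
qed simp

section \<open>Closed form of the partition function and comparison with the stated summand\<close>

text \<open>The true range of \<open>l\<close> ends at \<open>d + i - N\<close>, which is at most
  \<open>d\<close> since \<open>i \<le> N\<close>. Padding with zeros to the common range up to
  \<open>d\<close> allows the sums over \<open>i\<close> and \<open>l\<close> to be
  exchanged.\<close>

lemma wcount_closed_form_even:
  fixes \<kappa> :: "'a::field_char_0"
  assumes "y + 2 * d > 0" "i \<le> N"
  shows "wcount \<kappa> (y + 2 * d + 2 * i) (int y + 2 * int N) =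
     (\<Sum>l\<le>d. \<kappa> ^ Suc l * (of_nat (y + l + 2 * N) *
        (if N + l \<le> d + i then fact (y + 2 * d + 2 * i - l - 1) / (fact (d + i - N - l) * fact (y + d + i + N)) else 0)))"
proof (cases "N \<le> d + i")
  case True
  then obtain h where "d + i = N + h" using le_Suc_ex by blast
  then have h: "y + 2 * d + 2 * i = 2 * h + (y + 2 * N)" "d + i - N = h" "y + d + i + N = h + (y + 2 * N)"
     and hd: "h \<le> d" and le: "N + l \<le> d + i \<longleftrightarrow> l \<le> h" for l
    using assms(2) by auto
  have pos: "2 * h + (y + 2 * N) > 0"
    using assms h(1) by linarith
  have "int y + 2 * int N = int (y + 2 * N)" by simp
  then have "wcount \<kappa> (y + 2 * d + 2 * i) (int y + 2 * int N) = (\<Sum>l\<le>h. wcoef h (y + 2 * N) l * \<kappa> ^ Suc l)"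
    unfolding h using wcount_closed_form[OF pos, of \<kappa>] by simp
  also have "\<dots> = (\<Sum>l\<le>d. wcoef h (y + 2 * N) l * \<kappa> ^ Suc l)"
    using hd by (intro sum.mono_neutral_left) (auto simp: wcoef_def)
  finally show ?thesis
    unfolding le h wcoef_def by (simp only:) (intro sum.cong refl, auto simp: ac_simps)
next
  case False
  then show ?thesis using assms by (simp add: wcount_above)
qed

lemma Z_eq_wsum: "Z n t y \<kappa> = wsum \<kappa> n t (\<lambda>j. int y + 2 * int j)"
  by (simp add: Z_def wsum_def vicious_families_def families_def)

text \<open>Once \<open>\<kappa> ^ N\<close> is cancelled, \<open>det_last_column\<close> leaves the
  ballot determinant of size \<open>N\<close>, the reciprocal of the last weight, and the weighted
  last row. The inner sum over \<open>i\<close> is the one that \<open>whipple_special\<close>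
  transforms.\<close>

lemma Z_closed_form_nonzero:
  fixes \<kappa> :: "'a::field_char_0"
  assumes "\<kappa> \<noteq> 0" and t: "t = y + 2 * d" "t > 0"
  shows "Z (Suc N) t y \<kappa> =
     (\<Prod>i<N. fact (t + 2 * i) * fact i * fact (y + N + i)
         / (fact (d + i) * fact (y + d + N + i) * fact (y + 2 * i)))
     * ((-1) ^ N * fact (t + 2 * N) / (fact (y + d + 2 * N) * fact (d + N)))
     * (\<Sum>l\<le>d. \<kappa> ^ Suc l * (of_nat (y + l + 2 * N) * (\<Sum>i\<le>N. (-1) ^ i * of_nat (N choose i)
      * (if N + l \<le> d + i then fact (d + i) / fact (d + i - N - l) else 0)
      * (fact (t + 2 * i - l - 1) / fact (t + 2 * i)))))"
    (is "_ = ?P * ?u * ?S")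
proof -
  let ?f = "\<lambda>j i. if j < N then wcount 1 (t + 2 * i) (int y + 2 * int j) else wcount \<kappa> (t + 2 * i) (int y + 2 * int j)"
  have "wsum \<kappa> (Suc N) t (\<lambda>j. int y + 2 * int j) * \<kappa> ^ N = wdet \<kappa> (Suc N) t (\<lambda>j. int y + 2 * int j)"
    by (rule wsum_eq_wdet) (auto simp: t)
  then have Z: "Z (Suc N) t y \<kappa> = det (mat (Suc N) (Suc N) (\<lambda>(j, i). ?f j i))"
    using \<open>\<kappa> \<noteq> 0\<close> unfolding Z_eq_wsum wdet_elim by simp
  have "det (mat (Suc N) (Suc N) (\<lambda>(j, i). ?f j i)) * rowweight N y d N
      = (\<Sum>i\<le>N. ?f N i * rowweight N y d i) * det (mat N N (\<lambda>(j, i). ?f j i))"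
    by (rule det_last_column) (simp add: t rowweight_annihilates)
  also have "det (mat N N (\<lambda>(j, i). ?f j i)) = det (mat N N (\<lambda>(j, i). wcount 1 (t + 2 * i) (int y + 2 * int j)))"
    by (intro arg_cong[of _ _ det] eq_matI) auto
  also have "\<dots> = ?P"
    unfolding t(1) by (rule ballot_det)
  also have "(\<Sum>i\<le>N. ?f N i * rowweight N y d i) = ?S"
  proof -
    have "?f N i * rowweight N y d i = (\<Sum>l\<le>d. \<kappa> ^ Suc l * (of_nat (y + l + 2 * N) * ((-1) ^ i * of_nat (N choose i)
      * (if N + l \<le> d + i then fact (d + i) / fact (d + i - N - l) else 0)
      * (fact (t + 2 * i - l - 1) / fact (t + 2 * i)))))" if "i \<le> N" for i
    proof -
      have "?f N i * rowweight N y d i = (\<Sum>l\<le>d. \<kappa> ^ Suc l * (of_nat (y + l + 2 * N) *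
        (if N + l \<le> d + i then fact (t + 2 * i - l - 1) / (fact (d + i - N - l) * fact (y + d + i + N)) else 0)) * rowweight N y d i)"
        using wcount_closed_form_even[of y d i N \<kappa>] that t by (simp only: less_irrefl if_False sum_distrib_right)
      also have "\<dots> = (\<Sum>l\<le>d. \<kappa> ^ Suc l * (of_nat (y + l + 2 * N) * ((-1) ^ i * of_nat (N choose i)
        * (if N + l \<le> d + i then fact (d + i) / fact (d + i - N - l) else 0)
        * (fact (t + 2 * i - l - 1) / fact (t + 2 * i)))))"
        by (intro sum.cong refl) (simp add: rowweight_def t(1))
      finally show ?thesis .
    qed
    then have "(\<Sum>i\<le>N. ?f N i * rowweight N y d i) = (\<Sum>i\<le>N. \<Sum>l\<le>d. \<kappa> ^ Suc l * (of_nat (y + l + 2 * N) * ((-1) ^ i * of_nat (N choose i)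
      * (if N + l \<le> d + i then fact (d + i) / fact (d + i - N - l) else 0)
      * (fact (t + 2 * i - l - 1) / fact (t + 2 * i)))))"
      by (intro sum.cong refl) (simp only: atMost_iff)
    also have "\<dots> = ?S"
      by (subst sum.swap) (simp only: sum_distrib_left)
    finally show ?thesis .
  qed
  also have "?S * ?P = ?P * ?u * ?S * rowweight N y d N"
  proof -
    have "?u * rowweight N y d N = 1"
      by (simp add: rowweight_def t(1) mult_2 add.assoc)
    moreover have "p * u * s * w = s * p * (u * w)" for p u s w :: 'a
      by simp
    ultimately show ?thesis
      by (simp only: mult_1_right)
  qed
  finally have eq: "Z (Suc N) t y \<kappa> * rowweight N y d N = ?P * ?u * ?S * rowweight N y d N"
    unfolding Z .
  have "rowweight N y d N \<noteq> (0 :: 'a)"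
    by (simp add: rowweight_def)
  then show ?thesis
    using eq by (rule iffD1[OF mult_right_cancel])
qed

lemma binom_pochhammer: "binom m (int k) * fact k = pochhammer (of_int m - of_nat k + 1) k"
  by (simp add: binom_def gbinomial_pochhammer')

lemma binom_of_nat: "binom (int m) (int k) = of_nat (m choose k)"
  by (simp add: binom_def binomial_gbinomial)

text \<open>Brings the stated summand to the form on the right of \<open>whipple_special\<close>.
  \<open>pochhammer (of_nat (y + d)) k\<close> cancels the \<open>k\<close>-dependence of a
  factorial in the third binomial's denominator.\<close>

lemma summand_closed_form:
  fixes N y d l k :: nat
  assumes t: "t = y + 2 * d" "t > 0" and l: "l \<le> d" and k: "k \<le> N"
  shows "(-1) ^ k
         * binom (int (Suc N) - 1) (int k)
         * binom (int y + 2 * int k - 2) (2 * int k)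
         * binom (int t - int l - 1) (int d - int l - int k)
         * binom (int y + int l + 2 * int (Suc N) - 2) (2 * int (Suc N) - 2 * int k - 1)
         * (pochhammer (of_nat (y + d)) k * fact (2 * Suc N - 2 * k - 1) * fact (2 * k)
            / pochhammer (of_int (int d + int (Suc N) - int k)) k)
    = fact (t - l - 1) / (fact (y + d - 1) * fact (d + N)) * of_nat (y + l + 2 * N) * (-1) ^ N *
      ((-1) ^ (N - k) * of_nat (N choose k) * pochhammer (of_nat y - 1) (2 * k)
      * pochhammer (of_nat (y + l + 2 * k)) (2 * N - 2 * k)
      * (if k + l \<le> d then fact (d + N - k) / fact (d - l - k) else 0) :: 'a::field_char_0)"
proof -
  define s where "s = y + d"
  have s: "s > 0" using t by (simp add: s_def)
  have 1: "binom (int (Suc N) - 1) (int k) = (of_nat (N choose k) :: 'a)"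
    by (simp add: binom_def binomial_gbinomial)
  have 2: "binom (int y + 2 * int k - 2) (2 * int k) * fact (2 * k) = (pochhammer (of_nat y - 1) (2 * k) :: 'a)"
    using binom_pochhammer[of "int y + 2 * int k - 2" "2 * k", where ?'a = 'a] by simp
  have 3: "binom (int t - int l - 1) (int d - int l - int k) =
      (if k + l \<le> d then fact (t - l - 1) / (fact (d - l - k) * fact (s + k - 1)) else 0 :: 'a)"
  proof (cases "k + l \<le> d")
    case True
    then have "int t - int l - 1 = int (t - l - 1)" "int d - int l - int k = int (d - l - k)"
      "d - l - k \<le> t - l - 1" "t - l - 1 - (d - l - k) = s + k - 1"
      using t by (auto simp: s_def)
    then show ?thesis using True
      by (simp only: binom_of_nat binomial_fact if_True)
  qed (simp add: binom_def)
  \<comment> \<open>The odd lower index yields one factor more than Whipple's sum contains; this top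
    factor \<open>y + l + 2 * N\<close> is the numerator factor of \<open>wcoef\<close>.\<close>
  have 4: "binom (int y + int l + 2 * int (Suc N) - 2) (2 * int (Suc N) - 2 * int k - 1) * fact (2 * Suc N - 2 * k - 1)
     = (pochhammer (of_nat (y + l + 2 * k)) (2 * N - 2 * k) * of_nat (y + l + 2 * N) :: 'a)"
  proof -
    have "2 * int (Suc N) - 2 * int k - 1 = int (Suc (2 * N - 2 * k))" "2 * Suc N - 2 * k - 1 = Suc (2 * N - 2 * k)"
      "int y + int l + 2 * int (Suc N) - 2 = int (y + l + 2 * N)"
      using k by auto
    then have "binom (int y + int l + 2 * int (Suc N) - 2) (2 * int (Suc N) - 2 * int k - 1) * fact (2 * Suc N - 2 * k - 1)
      = (pochhammer (of_int (int (y + l + 2 * N)) - of_nat (Suc (2 * N - 2 * k)) + 1) (Suc (2 * N - 2 * k)) :: 'a)"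
      by (simp only: binom_pochhammer)
    also have "of_int (int (y + l + 2 * N)) - of_nat (Suc (2 * N - 2 * k)) + 1 = (of_nat (y + l + 2 * k) :: 'a)"
      using k by (simp add: of_nat_diff)
    also have "pochhammer (of_nat (y + l + 2 * k)) (Suc (2 * N - 2 * k)) =
       (pochhammer (of_nat (y + l + 2 * k)) (2 * N - 2 * k) * of_nat (y + l + 2 * k + (2 * N - 2 * k)) :: 'a)"
      by (simp only: pochhammer_Suc of_nat_add)
    also have "y + l + 2 * k + (2 * N - 2 * k) = y + l + 2 * N" using k by simp
    finally show ?thesis .
  qed
  have 5: "pochhammer (of_nat s) k = (fact (s + k - 1) / fact (s - 1) :: 'a)"
  proof -
    have "of_nat s = (of_nat (s - 1) + 1 :: 'a)" "s - 1 + k = s + k - 1" using s by (simp_all add: of_nat_diff)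
    then show ?thesis by (simp only: pochhammer_of_nat_Suc)
  qed
  have 6: "pochhammer (of_int (int d + int (Suc N) - int k)) k = (fact (d + N) / fact (d + N - k) :: 'a)"
  proof -
    have "of_int (int d + int (Suc N) - int k) = (of_nat (d + N - k) + 1 :: 'a)" "d + N - k + k = d + N"
      using k by (simp_all add: of_nat_diff)
    then show ?thesis by (simp only: pochhammer_of_nat_Suc)
  qed
  have sign: "(-1) ^ k = ((-1) ^ N * (-1) ^ (N - k) :: 'a)"
    using k by (simp add: minus_one_power_iff)
  let ?b1 = "binom (int (Suc N) - 1) (int k) :: 'a"
  let ?b2 = "binom (int y + 2 * int k - 2) (2 * int k) :: 'a"
  let ?b3 = "binom (int t - int l - 1) (int d - int l - int k) :: 'a"
  let ?b4 = "binom (int y + int l + 2 * int (Suc N) - 2) (2 * int (Suc N) - 2 * int k - 1) :: 'a"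
  have "(-1) ^ k * ?b1 * ?b2 * ?b3 * ?b4
         * (pochhammer (of_nat s) k * fact (2 * Suc N - 2 * k - 1) * fact (2 * k)
            / pochhammer (of_int (int d + int (Suc N) - int k)) k)
     = (-1) ^ k * ?b1 * (?b2 * fact (2 * k)) * ?b3 * (?b4 * fact (2 * Suc N - 2 * k - 1))
         * (pochhammer (of_nat s) k / pochhammer (of_int (int d + int (Suc N) - int k)) k)"
    by (simp only: times_divide_eq_right times_divide_eq_left mult_ac)
  also have "\<dots> = fact (t - l - 1) / (fact (s - 1) * fact (d + N)) * of_nat (y + l + 2 * N) * (-1) ^ N *
      ((-1) ^ (N - k) * of_nat (N choose k) * pochhammer (of_nat y - 1) (2 * k)
      * pochhammer (of_nat (y + l + 2 * k)) (2 * N - 2 * k)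
      * (if k + l \<le> d then fact (d + N - k) / fact (d - l - k) else 0))"
    unfolding 1 2 3 4 5 6 sign by (simp add: mult_ac)
  finally show ?thesis unfolding s_def .
qed

text \<open>Every family contains the contact \<open>(0, 0)\<close>. This settles the one value of
  \<open>\<kappa>\<close> for which \<open>\<kappa> ^ N\<close> may not be cancellable.\<close>

lemma Z_zero:
  assumes "n > 0"
  shows "Z n t y (0 :: 'a::field_char_0) = 0"
  unfolding Z_def
proof (intro sum.neutral ballI)
  fix P assume P: "P \<in> vicious_families n t y"
  then have "walk (0, 0) (int t, int y) (P ! 0)" "P ! 0 \<in> set P"
    using assms by (auto simp: vicious_families_def)
  moreover from this have "(0, 0) \<in> set (P ! 0)"
    by (metis hd_in_set walk_def)
  ultimately have "(0, 0) \<in> {q. snd q = 0 \<and> (\<exists>p\<in>set P. q \<in> set p)}"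
    by auto
  moreover have "finite {q. snd q = 0 \<and> (\<exists>p\<in>set P. q \<in> set p)}"
    by (rule finite_subset[of _ "\<Union>p\<in>set P. set p"]) auto
  ultimately have "contacts P > 0"
    unfolding contacts_def by (auto simp: card_gt_0_iff)
  then show "(0::'a) ^ contacts P = 0" by simp
qed

lemma Z_above:
  assumes "n > 0" "t < y"
  shows "Z n t y \<kappa> = 0"
proof -
  have "vicious_families n t y = {}"
  proof (rule equals0I)
    fix P assume "P \<in> vicious_families n t y"
    then have "walk (0, 0) (int t, int y) (P ! 0)"
      using assms by (auto simp: vicious_families_def)
    then show False
      using walk_length_bounds(2)[of "P ! 0" "(int t, int y)"] assms(2) walk_end by (force simp: walk_def)
  qed
  then show ?thesis by (simp add: Z_def)
qed

theorem theorem8: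
  fixes n t y :: nat and \<kappa> :: "'a::field_char_0"
  defines "s \<equiv> (t + y) div 2" and "d \<equiv> (int t - int y) div 2"
  assumes "n \<ge> 1" and "t \<ge> 1" and "t mod 2 = y mod 2"
  shows "Z n t y \<kappa> =
    fact (s - 1) / fact (s + 2 * n - 2)
    * (\<Prod>i<n - 1.
         fact (t + 2 * i) * fact i * fact (y + n + i - 1) * recip_fact (d + int i)
         / (fact (s + n + i - 1) * fact (y + 2 * i)))
    * (\<Sum>l | int l \<le> d. \<Sum>k<n.
         (-1) ^ k
         * binom (int n - 1) (int k)
         * binom (int y + 2 * int k - 2) (2 * int k)
         * binom (int t - int l - 1) (d - int l - int k)
         * binom (int y + int l + 2 * int n - 2) (2 * int n - 2 * int k - 1)
         * (pochhammer (of_nat s) k * fact (2 * n - 2 * k - 1) * fact (2 * k)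
            / pochhammer (of_int (d + int n - int k)) k)
         * \<kappa> ^ (l + 1))"
proof -
  \<comment> \<open>In the first case \<open>d\<close> is negative and the sum over \<open>l\<close>
    is empty; in the second every summand contains a positive power of
    \<open>\<kappa>\<close>.\<close>
  consider "t < y" | "\<kappa> = 0" | "y \<le> t" "\<kappa> \<noteq> 0" by linarith
  then show ?thesis
  proof cases
    case 1
    then have "d < 0" by (simp add: d_def)
    then have "{l. int l \<le> d} = {}" by auto
    then show ?thesis using 1 \<open>n \<ge> 1\<close> by (simp add: Z_above)
  next
    case 2
    then show ?thesis using \<open>n \<ge> 1\<close> by (simp add: Z_zero)
  next
    case 3
    obtain N where n: "n = Suc N" using \<open>n \<ge> 1\<close> by (cases n) auto
    have "even (t - y)" using 3 assms(5) by (simp add: mod_eq_dvd_iff_nat)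
    then obtain D where t: "t = y + 2 * D" using 3 by (metis dvdE le_add_diff_inverse)
    have sD: "s = y + D" and dD: "d = int D" by (simp_all add: s_def d_def t)
    have ls: "{l. int l \<le> d} = {..D}" by (auto simp: dD)
    define L where "L l = (\<Sum>i\<le>N. (-1) ^ i * of_nat (N choose i)
      * (if N + l \<le> D + i then fact (D + i) / fact (D + i - N - l) else 0)
      * (fact (t + 2 * i - l - 1) / fact (t + 2 * i)) :: 'a)" for l
    let ?T = "\<lambda>l k. (-1) ^ k
         * binom (int n - 1) (int k)
         * binom (int y + 2 * int k - 2) (2 * int k)
         * binom (int t - int l - 1) (d - int l - int k)
         * binom (int y + int l + 2 * int n - 2) (2 * int n - 2 * int k - 1)
         * (pochhammer (of_nat s) k * fact (2 * n - 2 * k - 1) * fact (2 * k)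
            / pochhammer (of_int (d + int n - int k)) k) :: 'a"
    \<comment> \<open>The factor \<open>fact (t - l - 1)\<close> from
      \<open>summand_closed_form\<close> cancels against \<open>whipple_special\<close>, so the
      remaining constant is independent of \<open>l\<close>. It differs from that of
      \<open>Z_closed_form_nonzero\<close> only by \<open>fact (s - 1)\<close> in place of
      \<open>fact (s + 2 * N)\<close>, which is the prefactor of the theorem.\<close>
    have inner: "(\<Sum>k<n. ?T l k * \<kappa> ^ (l + 1)) = (fact (t + 2 * N) * (-1) ^ N / (fact (s - 1) * fact (D + N))) *
       (\<kappa> ^ Suc l * (of_nat (y + l + 2 * N) * L l))" if l: "l \<le> D" for l
    proof -
      have "(\<Sum>k<n. ?T l k) = (\<Sum>k\<le>N. fact (t - l - 1) / (fact (s - 1) * fact (D + N)) * of_nat (y + l + 2 * N) * (-1) ^ N *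
        ((-1) ^ (N - k) * of_nat (N choose k) * pochhammer (of_nat y - 1) (2 * k)
        * pochhammer (of_nat (y + l + 2 * k)) (2 * N - 2 * k)
        * (if k + l \<le> D then fact (D + N - k) / fact (D - l - k) else 0)))"
        unfolding n lessThan_Suc_atMost dD sD
        using \<open>t \<ge> 1\<close> l by (intro sum.cong refl summand_closed_form[OF t]) auto
      also have "\<dots> = fact (t - l - 1) / (fact (s - 1) * fact (D + N)) * of_nat (y + l + 2 * N) * (-1) ^ N *
         (L l * (fact (t + 2 * N) / fact (t - l - 1)))"
        unfolding sum_distrib_left[symmetric] L_def
        using whipple_special[OF t _ l, of N, where ?'a = 'a] \<open>t \<ge> 1\<close> by simp
      finally show ?thesis
        unfolding sum_distrib_right[symmetric] by simp
    qed
    have "Z n t y \<kappa> = (\<Prod>i<N. fact (t + 2 * i) * fact i * fact (y + N + i)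
         / (fact (D + i) * fact (y + D + N + i) * fact (y + 2 * i)))
     * ((-1) ^ N * fact (t + 2 * N) / (fact (s + 2 * N) * fact (D + N)))
     * (\<Sum>l\<le>D. \<kappa> ^ Suc l * (of_nat (y + l + 2 * N) * L l))"
      unfolding n L_def sD using 3 t \<open>t \<ge> 1\<close> by (intro Z_closed_form_nonzero) auto
    also have "(\<Prod>i<N. fact (t + 2 * i) * fact i * fact (y + N + i) / (fact (D + i) * fact (y + D + N + i) * fact (y + 2 * i)))
      = (\<Prod>i<n - 1. fact (t + 2 * i) * fact i * fact (y + n + i - 1) * recip_fact (d + int i)
         / (fact (s + n + i - 1) * fact (y + 2 * i)) :: 'a)"
      unfolding n by (intro prod.cong) (auto simp: recip_fact_def dD sD nat_add_distrib)
    finally have Z: "Z n t y \<kappa> = (\<Prod>i<n - 1. fact (t + 2 * i) * fact i * fact (y + n + i - 1) * recip_fact (d + int i)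
         / (fact (s + n + i - 1) * fact (y + 2 * i)))
     * ((-1) ^ N * fact (t + 2 * N) / (fact (s + 2 * N) * fact (D + N)))
     * (\<Sum>l\<le>D. \<kappa> ^ Suc l * (of_nat (y + l + 2 * N) * L l))" .
    have "(\<Sum>l\<le>D. \<Sum>k<n. ?T l k * \<kappa> ^ (l + 1)) = (fact (t + 2 * N) * (-1) ^ N / (fact (s - 1) * fact (D + N))) *
       (\<Sum>l\<le>D. \<kappa> ^ Suc l * (of_nat (y + l + 2 * N) * L l))"
      unfolding sum_distrib_left by (intro sum.cong refl inner) simp
    moreover have "s + 2 * n - 2 = s + 2 * N" by (simp add: n)
    ultimately show ?thesis
      unfolding ls Z by simp
  qed
qed

end
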